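(* Let $S$ be a non-empty set of primes. There exists a profinite group $G$ with the following properties: (1) $G$ is topologically perfect, i.e. $G=\overline{G'}$; (2) $\overline{G^{m}}$ is open in $G$ for each $m\in\mathbb{N}$, and for each $k\in\mathbb{N}$, $G$ has only finitely many open subgroups of index $k$; (3) if $m\in\mathbb{N}$ is coprime to every prime in $S$, then $G^{m}$ is open in $G$, and $G$ has only finitely many normal subgroups of index $m$; (4) if $p\in S$ then $G/G'G^{p}$ is infinite, and $G$ has uncountably many normal subgroups of index $p$, none of which is open; (5) $G'$ is not closed in $G$, and $G^{p}$ is not closed in $G$ for each $p\in S$.
   Context: For a group $G$, $G'$ denotes the (abstract) derived subgroup, i.e. the subgroup generated algebraically by all commutators, and for $m\in\mathbb{N}$, $G^{m}$ denotes the (abstract) subgroup generated algebraically by the set $\{g^m\mid g\in G\}$ of $m$th powers. $\overline{X}$ denotes the topological closure of a subset $X$ of a profinite group. Subgroups and normal subgroups of finite index referred to are abstract subgroups (not necessarily closed), unless said to be open. *)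

theory Defs
  imports "HOL-Analysis.Analysis" "HOL-Algebra.Algebra"
begin

definition topological_group :: "('a, 'b) monoid_scheme \<Rightarrow> 'a topology \<Rightarrow> bool" where
  "topological_group G T \<longleftrightarrow>
     group G \<and> topspace T = carrier G \<and>
     continuous_map (prod_topology T T) T (\<lambda>(x, y). x \<otimes>\<^bsub>G\<^esub> y) \<and>
     continuous_map T T (\<lambda>x. inv\<^bsub>G\<^esub> x)"

definition totally_disconnected_space :: "'a topology \<Rightarrow> bool" where
  "totally_disconnected_space T \<longleftrightarrow>
     (\<forall>C. connectedin T C \<longrightarrow> C = {} \<or> (\<exists>a. C = {a}))"

definition profinite_group :: "('a, 'b) monoid_scheme \<Rightarrow> 'a topology \<Rightarrow> bool" where
  "profinite_group G T \<longleftrightarrow>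
     topological_group G T \<and> compact_space T \<and> Hausdorff_space T \<and>
     totally_disconnected_space T"

definition derived_subgroup :: "('a, 'b) monoid_scheme \<Rightarrow> 'a set" where
  "derived_subgroup G = derived G (carrier G)"

definition power_subgroup :: "('a, 'b) monoid_scheme \<Rightarrow> nat \<Rightarrow> 'a set" where
  "power_subgroup G m = generate G {x [^]\<^bsub>G\<^esub> m | x. x \<in> carrier G}"

text \<open>Index of a subgroup (card of the set of right cosets; 0 if infinite).\<close>
definition group_index :: "('a, 'b) monoid_scheme \<Rightarrow> 'a set \<Rightarrow> nat" where
  "group_index G H = card (rcosets\<^bsub>G\<^esub> H)"

end

theory Submission
  imports Defs "HOL-Number_Theory.Cong"
begin

text \<open>
  The group is a Cartesian product of finite perfect groups \<open>L n\<close>, where each \<open>L n\<close> is attached to a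
  prime \<open>p = \<pi> n\<close> of \<open>S\<close> and every prime of \<open>S\<close> is attached to infinitely many \<open>n\<close>.

  To build \<open>L n\<close>, take $Q = SL_2$ over a prime field of order $l > n$ and the class-two $p$-group on
  $A \times Z$, with $A$ the functions $Q \times \{1..2r\} \to F_p$ and $Z$ the $r \times r$ matrices, whose
  multiplication is twisted by a $Q$-invariant bilinear form $A \times A \to Z$. In the semidirect
  product with $Q$ let \<open>L n\<close> be the normal closure of $Q$. It is perfect since $Q$ is, and it is generated
  by elements of order $l$, hence by $m$-th powers whenever $0 < m \le n$. If moreover $m$ is prime to
  $p$, every element is a product of five $m$-th powers: four unipotents of $Q$ and an element of the
  $p$-group. On the other hand \<open>L n\<close> contains the central subgroup $Z$ of exponent $p$, so commutators and
  $p$-th powers depend only on cosets of $Z$; as $|Z| = p^{r^2}$ outgrows every fixed power of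
  $|A| |Q|$ when $r$ grows, some element of \<open>L n\<close> is not a product of $n$ commutators and $p$-th powers.

  In the product, elements whose coordinates have unbounded verbal length on an infinite set of
  indices lie outside $G'G^p$. Spreading such coordinates over the members of an almost disjoint
  family of sets and extending to maximal subgroups by Zorn's lemma yields uncountably many normal
  subgroups of index $p$. All the finiteness and openness assertions hold because a subgroup of index
  $k$ contains all $k!$-th powers, and the closure of $G^m$ contains all factors with $n \ge m$.
\<close>

section \<open>Products of bounded length\<close>

text \<open>Exactly \<open>k\<close> factors are taken and inverses are not added. The sets
  \<open>powers\<close> and \<open>verbal\<close> contain the identity and are closed under
  inversion, so for them lengths are monotone in \<open>k\<close> and preserved by
  inversion.\<close>

primrec prods :: "('a, 'b) monoid_scheme \<Rightarrow> 'a set \<Rightarrow> nat \<Rightarrow> 'a set" where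
  "prods G C 0 = {\<one>\<^bsub>G\<^esub>}"
| "prods G C (Suc k) = prods G C k <#>\<^bsub>G\<^esub> C"

definition powers :: "('a, 'b) monoid_scheme \<Rightarrow> nat \<Rightarrow> 'a set" where
  "powers G m = {x [^]\<^bsub>G\<^esub> m | x. x \<in> carrier G}"

text \<open>This set generates G'G^p. The number of its elements needed to write a given element is
  the length that separates abstract subgroups from their closures.\<close>

definition verbal :: "('a, 'b) monoid_scheme \<Rightarrow> nat \<Rightarrow> 'a set" where
  "verbal G p = derived_set G (carrier G) \<union> powers G p"

lemma power_subgroup_eq: "power_subgroup G m = generate G (powers G m)"
  by (simp add: power_subgroup_def powers_def)

lemma derived_subgroup_eq: "derived_subgroup G = generate G (derived_set G (carrier G))"
  by (simp add: derived_subgroup_def derived_def)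

context group
begin

lemma prods_carrier: "C \<subseteq> carrier G \<Longrightarrow> prods G C k \<subseteq> carrier G"
  by (induction k) (auto simp: set_mult_def)

lemma prods_SucI: "x \<in> prods G C k \<Longrightarrow> c \<in> C \<Longrightarrow> x \<otimes> c \<in> prods G C (Suc k)"
  by (auto simp: set_mult_def)

lemma prods_SucE:
  assumes "x \<in> prods G C (Suc k)"
  obtains y c where "y \<in> prods G C k" "c \<in> C" "x = y \<otimes> c"
  using assms by (auto simp: set_mult_def)

lemma prods_add:
  assumes "C \<subseteq> carrier G" "x \<in> prods G C a" "y \<in> prods G C b"
  shows "x \<otimes> y \<in> prods G C (a + b)"
  using assms(3)
proof (induction b arbitrary: y)
  case 0
  then show ?case using assms prods_carrier[OF assms(1), of a] by auto
next
  case (Suc b)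
  then obtain z c where z: "z \<in> prods G C b" "c \<in> C" "y = z \<otimes> c"
    by (elim prods_SucE)
  have "x \<otimes> y = (x \<otimes> z) \<otimes> c"
    using z assms prods_carrier[OF assms(1)] by (metis m_assoc subsetD)
  then show ?case using Suc.IH[OF z(1)] z(2) prods_SucI by simp
qed

lemma prods_one: "\<one> \<in> C \<Longrightarrow> \<one> \<in> prods G C k"
proof (induction k)
  case (Suc k)
  then show ?case using prods_SucI[of \<one> C k \<one>] by simp
qed simp

lemma prods_mono:
  assumes "C \<subseteq> carrier G" "\<one> \<in> C" "a \<le> b"
  shows "prods G C a \<subseteq> prods G C b"
proof
  fix x assume x: "x \<in> prods G C a"
  have "x \<otimes> \<one> \<in> prods G C (a + (b - a))"
    using assms x by (intro prods_add prods_one)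
  moreover have "x \<in> carrier G" using x prods_carrier[OF assms(1)] by blast
  ultimately show "x \<in> prods G C b" using assms(3) by simp
qed

lemma prods_incl:
  assumes "C \<subseteq> carrier G" "c \<in> C" shows "c \<in> prods G C 1"
  using assms prods_SucI[of \<one> C 0 c] by (auto simp: subset_iff)

lemma prods_inv:
  assumes C: "C \<subseteq> carrier G" "\<And>c. c \<in> C \<Longrightarrow> inv c \<in> C" and "x \<in> prods G C k"
  shows "inv x \<in> prods G C k"
  using assms(3)
proof (induction k arbitrary: x)
  case (Suc k)
  then obtain z c where z: "z \<in> prods G C k" "c \<in> C" "x = z \<otimes> c"
    by (elim prods_SucE)
  have "inv x = inv c \<otimes> inv z"
    using z C prods_carrier[OF C(1)] by (metis inv_mult_group subsetD)
  moreover have "inv c \<otimes> inv z \<in> prods G C (1 + k)"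
    using C z Suc.IH by (intro prods_add prods_incl) auto
  ultimately show ?case by simp
qed auto

lemma prods_subgroup:
  assumes "subgroup H G" "C \<subseteq> H" shows "prods G C k \<subseteq> H"
proof (induction k)
  case 0
  then show ?case using assms(1) by (simp add: subgroup.one_closed)
next
  case (Suc k)
  then show ?case using assms by (auto elim!: prods_SucE simp del: prods.simps intro: subgroup.m_closed)
qed

lemma generate_subset_prods:
  assumes C: "C \<subseteq> carrier G" "\<And>c. c \<in> C \<Longrightarrow> inv c \<in> C" and x: "x \<in> generate G C"
  shows "\<exists>k. x \<in> prods G C k"
  using x
proof induction
  case one
  show ?case by (rule exI[of _ 0]) simp
next
  case (incl h)
  then show ?case using prods_incl[OF C(1)] by blast
next
  case (inv h)
  then show ?case using prods_incl[OF C(1)] C(2) by blast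
next
  case (eng h1 h2)
  then show ?case using prods_add[OF C(1)] by blast
qed

section \<open>Powers and verbal elements\<close>

lemma powers_carrier: "powers G m \<subseteq> carrier G"
  by (auto simp: powers_def)

lemma powers_one: "\<one> \<in> powers G m"
  unfolding powers_def using nat_pow_one by force

lemma powers_inv: "c \<in> powers G m \<Longrightarrow> inv c \<in> powers G m"
  unfolding powers_def by (auto simp: nat_pow_inv[symmetric])

lemma verbal_carrier: "verbal G p \<subseteq> carrier G"
  using powers_carrier[of p] by (auto simp: verbal_def)

lemma verbal_one: "\<one> \<in> verbal G p"
  using powers_one[of p] by (auto simp: verbal_def)

lemma derived_set_inv:
  assumes "c \<in> derived_set G (carrier G)" shows "inv c \<in> derived_set G (carrier G)"
proof -
  obtain x y where xy: "x \<in> carrier G" "y \<in> carrier G" "c = x \<otimes> y \<otimes> inv x \<otimes> inv y"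
    using assms by auto
  then have "inv c = y \<otimes> x \<otimes> inv y \<otimes> inv x"
    by (simp add: inv_mult_group m_assoc)
  moreover have "y \<otimes> x \<otimes> inv y \<otimes> inv x \<in> derived_set G (carrier G)"
    using xy(1,2) by blast
  ultimately show ?thesis by simp
qed

lemma verbal_inv: "c \<in> verbal G p \<Longrightarrow> inv c \<in> verbal G p"
  unfolding verbal_def using powers_inv[of c p] derived_set_inv[of c] by (simp only: Un_iff) blast

lemma prods_power_subgroup: "prods G (powers G m) k \<subseteq> power_subgroup G m"
  unfolding power_subgroup_eq
  by (intro prods_subgroup generate_is_subgroup powers_carrier) (auto intro: generate.incl)

lemma subgroup_power_subgroup: "subgroup (power_subgroup G m) G"
  unfolding power_subgroup_eq by (intro generate_is_subgroup powers_carrier)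

lemma subgroup_derived_subgroup: "subgroup (derived_subgroup G) G"
  unfolding derived_subgroup_def by (simp add: derived_is_subgroup)

text \<open>Commutators are verbal elements for every \<open>p\<close>, so in a perfect group each
  element has some finite verbal length.\<close>

lemma derived_subset_prods:
  "x \<in> derived G (carrier G) \<Longrightarrow> \<exists>k. x \<in> prods G (verbal G p) k"
proof -
  assume "x \<in> derived G (carrier G)"
  moreover have "derived G (carrier G) \<subseteq> generate G (verbal G p)"
    unfolding derived_def by (rule mono_generate) (simp add: verbal_def)
  ultimately show ?thesis
    using generate_subset_prods[OF verbal_carrier verbal_inv] by blast
qed

text \<open>By Bezout \<open>m * s = k * t + 1\<close>, so \<open>x\<close> is the
  \<open>m\<close>-th power of its own power \<open>x [^] s\<close>; the root stays in every
  subgroup containing \<open>x\<close>.\<close>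

lemma mem_powers_coprime:
  assumes "x \<in> carrier G" "x [^] (k::nat) = \<one>" "coprime m k"
  shows "x \<in> powers G m"
proof (cases "m = 0")
  case True
  \<comment> \<open>\<open>coprime 0 k\<close> forces \<open>k = 1\<close>, so the torsion
    hypothesis already says that \<open>x\<close> is the identity.\<close>
  then have "x = \<one>" using assms by simp
  then show ?thesis using powers_one by simp
next
  case False
  obtain s t where st: "m * s = k * t + 1"
    using bezout_nat[OF False, of k] assms(3) by auto
  have "(x [^] s) [^] m = x [^] (k * t + 1)"
    using assms(1) st by (simp add: nat_pow_pow mult.commute)
  also have "\<dots> = x"
    using assms(1,2) by (simp add: nat_pow_mult[symmetric] nat_pow_pow[symmetric])
  finally show ?thesis using assms(1) by (auto simp: powers_def intro!: exI[of _ "x [^] s"])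
qed

end

section \<open>The group $SL_2$ over a prime field\<close>

text \<open>Entries are stored, row by row, as residues reduced modulo \<open>l\<close>, so equality
  of matrices is congruence of entries.\<close>

definition mat2 :: "int \<Rightarrow> int \<Rightarrow> int \<Rightarrow> int \<Rightarrow> int \<Rightarrow> int \<times> int \<times> int \<times> int" where
  "mat2 l a b c d = (a mod l, b mod l, c mod l, d mod l)"

definition sl2 :: "int \<Rightarrow> (int \<times> int \<times> int \<times> int) monoid" where
  "sl2 l = \<lparr>carrier = {mat2 l a b c d | a b c d. [a * d - b * c = 1] (mod l)},
     monoid.mult = (\<lambda>(a, b, c, d) (a', b', c', d').
       mat2 l (a * a' + b * c') (a * b' + b * d') (c * a' + d * c') (c * b' + d * d')),
     one = mat2 l 1 0 0 1\<rparr>"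

lemma mat2_cong:
  "[a = a'] (mod l) \<Longrightarrow> [b = b'] (mod l) \<Longrightarrow> [c = c'] (mod l) \<Longrightarrow> [d = d'] (mod l) \<Longrightarrow>
   mat2 l a b c d = mat2 l a' b' c' d'"
  by (simp add: mat2_def cong_def)

lemma mult_sl2:
  "mat2 l a b c d \<otimes>\<^bsub>sl2 l\<^esub> mat2 l a' b' c' d' =
   mat2 l (a * a' + b * c') (a * b' + b * d') (c * a' + d * c') (c * b' + d * d')"
proof -
  have "mat2 l a b c d \<otimes>\<^bsub>sl2 l\<^esub> mat2 l a' b' c' d' =
      mat2 l ((a mod l) * (a' mod l) + (b mod l) * (c' mod l)) ((a mod l) * (b' mod l) + (b mod l) * (d' mod l))
       ((c mod l) * (a' mod l) + (d mod l) * (c' mod l)) ((c mod l) * (b' mod l) + (d mod l) * (d' mod l))"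
    by (simp add: sl2_def mat2_def)
  then show ?thesis
    by (simp only:) (intro mat2_cong cong_add cong_mult; simp add: cong_def)
qed

lemma one_sl2: "\<one>\<^bsub>sl2 l\<^esub> = mat2 l 1 0 0 1"
  by (simp add: sl2_def)

lemma carrier_sl2I: "[a * d - b * c = 1] (mod l) \<Longrightarrow> mat2 l a b c d \<in> carrier (sl2 l)"
  by (auto simp: sl2_def)

lemma carrier_sl2E:
  assumes "x \<in> carrier (sl2 l)"
  obtains a b c d where "x = mat2 l a b c d" "[a * d - b * c = 1] (mod l)"
  using assms by (auto simp: sl2_def)

lemma group_sl2: "group (sl2 l)"
proof (rule groupI)
  fix x y assume "x \<in> carrier (sl2 l)" "y \<in> carrier (sl2 l)"
  then obtain a b c d a' b' c' d' where
    *: "x = mat2 l a b c d" "[a * d - b * c = 1] (mod l)"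
       "y = mat2 l a' b' c' d'" "[a' * d' - b' * c' = 1] (mod l)"
    by (elim carrier_sl2E)
  have "[(a * d - b * c) * (a' * d' - b' * c') = 1 * 1] (mod l)"
    using * by (intro cong_mult)
  then show "x \<otimes>\<^bsub>sl2 l\<^esub> y \<in> carrier (sl2 l)"
    unfolding *(1,3) mult_sl2 by (intro carrier_sl2I) (simp add: algebra_simps)
next
  show "\<one>\<^bsub>sl2 l\<^esub> \<in> carrier (sl2 l)"
    by (simp add: one_sl2 carrier_sl2I)
next
  fix x y z assume "x \<in> carrier (sl2 l)" "y \<in> carrier (sl2 l)" "z \<in> carrier (sl2 l)"
  then show "x \<otimes>\<^bsub>sl2 l\<^esub> y \<otimes>\<^bsub>sl2 l\<^esub> z = x \<otimes>\<^bsub>sl2 l\<^esub> (y \<otimes>\<^bsub>sl2 l\<^esub> z)"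
    by (elim carrier_sl2E) (simp add: mult_sl2 algebra_simps)
next
  fix x assume "x \<in> carrier (sl2 l)"
  then show "\<one>\<^bsub>sl2 l\<^esub> \<otimes>\<^bsub>sl2 l\<^esub> x = x"
    by (elim carrier_sl2E) (simp add: one_sl2 mult_sl2)
next
  fix x assume "x \<in> carrier (sl2 l)"
  then obtain a b c d where *: "x = mat2 l a b c d" "[a * d - b * c = 1] (mod l)"
    by (elim carrier_sl2E)
  have "mat2 l d (-b) (-c) a \<in> carrier (sl2 l)"
    using *(2) by (intro carrier_sl2I) (simp add: algebra_simps)
  moreover have "mat2 l d (-b) (-c) a \<otimes>\<^bsub>sl2 l\<^esub> x = \<one>\<^bsub>sl2 l\<^esub>"
    unfolding *(1) mult_sl2 one_sl2 using *(2)
    by (intro mat2_cong) (simp_all add: algebra_simps)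
  ultimately show "\<exists>y\<in>carrier (sl2 l). y \<otimes>\<^bsub>sl2 l\<^esub> x = \<one>\<^bsub>sl2 l\<^esub>" by blast
qed

lemma finite_sl2: "l > 0 \<Longrightarrow> finite (carrier (sl2 l))"
  by (rule finite_subset[of _ "{0..<l} \<times> {0..<l} \<times> {0..<l} \<times> {0..<l}"])
     (auto simp: sl2_def mat2_def)

lemma inv_sl2:
  assumes "[a * d - b * c = 1] (mod l)"
  shows "inv\<^bsub>sl2 l\<^esub> (mat2 l a b c d) = mat2 l d (-b) (-c) a"
proof (rule group.inv_equality[OF group_sl2])
  show "mat2 l d (-b) (-c) a \<otimes>\<^bsub>sl2 l\<^esub> mat2 l a b c d = \<one>\<^bsub>sl2 l\<^esub>"
    unfolding mult_sl2 one_sl2 using assms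
    by (intro mat2_cong) (simp_all add: algebra_simps)
  show "mat2 l d (-b) (-c) a \<in> carrier (sl2 l)"
    using assms by (intro carrier_sl2I) (simp add: algebra_simps)
qed (rule carrier_sl2I[OF assms])

definition torsion :: "('a, 'b) monoid_scheme \<Rightarrow> nat \<Rightarrow> 'a set" where
  "torsion G n = {x \<in> carrier G. x [^]\<^bsub>G\<^esub> n = \<one>\<^bsub>G\<^esub>}"

lemma upper_pow: "mat2 l 1 b 0 1 [^]\<^bsub>sl2 l\<^esub> (n::nat) = mat2 l 1 (int n * b) 0 1"
  by (induction n) (simp_all add: nat_pow_def one_sl2 mult_sl2 algebra_simps)

lemma lower_pow: "mat2 l 1 0 c 1 [^]\<^bsub>sl2 l\<^esub> (n::nat) = mat2 l 1 0 (int n * c) 1"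
  by (induction n) (simp_all add: nat_pow_def one_sl2 mult_sl2 algebra_simps)

text \<open>The upper and lower unipotents: for prime \<open>l\<close> they generate the group, and
  all of them have order dividing \<open>l\<close>.\<close>

definition elementary :: "int \<Rightarrow> (int \<times> int \<times> int \<times> int) set" where
  "elementary l = {mat2 l 1 b 0 1 | b. True} \<union> {mat2 l 1 0 c 1 | c. True}"

lemma upper_elementary: "mat2 l 1 b 0 1 \<in> elementary l"
  and lower_elementary: "mat2 l 1 0 c 1 \<in> elementary l"
  by (auto simp: elementary_def)

lemma elementary_carrier: "elementary l \<subseteq> carrier (sl2 l)"
  unfolding elementary_def by (auto simp del: split_paired_All intro!: carrier_sl2I)

lemma one_elementary: "\<one>\<^bsub>sl2 l\<^esub> \<in> elementary l"
  unfolding one_sl2 by (rule upper_elementary)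

lemma elementary_torsion: "elementary (int l) \<subseteq> torsion (sl2 (int l)) l"
proof
  fix x assume "x \<in> elementary (int l)"
  then have "x \<in> carrier (sl2 (int l)) \<and> x [^]\<^bsub>sl2 (int l)\<^esub> l = mat2 (int l) 1 0 0 1"
    using elementary_carrier unfolding elementary_def
    by (auto simp only: upper_pow lower_pow Un_iff mem_Collect_eq subset_iff) (auto simp: mat2_def)
  then show "x \<in> torsion (sl2 (int l)) l"
    by (simp add: torsion_def one_sl2)
qed

lemma prime_cong_inverse:
  assumes "Factorial_Ring.prime (l::nat)" "\<not> int l dvd c"
  obtains e where "[c * e = 1] (mod int l)"
proof -
  have "coprime c (int l)"
    using assms by (metis coprime_commute prime_imp_coprime prime_nat_int_transfer)
  then show thesis using cong_solve_coprime_int that by blast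
qed

text \<open>As \<open>e\<close> inverts \<open>c\<close>, the two upper entries can be chosen so
  that the product has diagonal \<open>a\<close>, \<open>d\<close>; the determinant condition then
  makes its upper right entry \<open>b\<close>.\<close>

lemma sl2_factor:
  assumes "[a * d - b * c = 1] (mod l)" "[c * e = 1] (mod l)"
  shows "mat2 l a b c d = mat2 l 1 ((a - 1) * e) 0 1 \<otimes>\<^bsub>sl2 l\<^esub> mat2 l 1 0 c 1
           \<otimes>\<^bsub>sl2 l\<^esub> mat2 l 1 ((d - 1) * e) 0 1"
proof -
  have A: "[(a - 1) * e * c = a - 1] (mod l)" for a
    using cong_mult[OF cong_refl[of "a - 1"] assms(2)] by (simp add: mult_ac)
  have "[(d - 1) * e * (1 + (a - 1) * e * c) + (a - 1) * e = (d - 1) * e * (1 + (a - 1)) + (a - 1) * e] (mod l)"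
    by (intro cong_add cong_mult A cong_refl)
  also have "(d - 1) * e * (1 + (a - 1)) + (a - 1) * e = (a * d - b * c) * e - e + b * (c * e)"
    by (simp add: algebra_simps)
  also have "[\<dots> = 1 * e - e + b * 1] (mod l)"
    by (intro cong_add cong_diff cong_mult assms cong_refl)
  finally have B: "[(d - 1) * e * (1 + (a - 1) * e * c) + (a - 1) * e = b] (mod l)" by simp
  have D: "[c * ((d - 1) * e) + 1 = d - 1 + 1] (mod l)"
    using A[of d] by (intro cong_add cong_refl) (simp add: mult_ac)
  have A': "[1 + (a - 1) * e * c = 1 + (a - 1)] (mod l)" by (intro cong_add cong_refl A)
  show ?thesis
    unfolding mult_sl2 using A' B D
    by (intro mat2_cong) (simp_all add: cong_sym_eq mult_ac)
qed

text \<open>Three unipotents suffice when \<open>c\<close> is invertible. Otherwise \<open>a\<close>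
  is invertible, adding the first row to the second reaches that case, and undoing this costs a
  fourth factor. The bound does not depend on \<open>l\<close>.\<close>

lemma sl2_prods_elementary:
  assumes l: "Factorial_Ring.prime (l::nat)"
  shows "carrier (sl2 (int l)) \<subseteq> prods (sl2 (int l)) (elementary (int l)) 4"
proof
  let ?Q = "sl2 (int l)" and ?C = "elementary (int l)"
  interpret group ?Q by (rule group_sl2)
  have C: "?C \<subseteq> carrier ?Q" "\<one>\<^bsub>?Q\<^esub> \<in> ?C" by (rule elementary_carrier one_elementary)+
  have 3: "mat2 (int l) a b c d \<in> prods ?Q ?C 3"
    if det: "[a * d - b * c = 1] (mod int l)" and c: "\<not> int l dvd c" for a b c d
  proof -
    obtain e where e: "[c * e = 1] (mod int l)" using prime_cong_inverse[OF l c] .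
    have "mat2 (int l) a b c d \<in> prods ?Q ?C (1 + 1 + 1)"
      unfolding sl2_factor[OF det e]
      by (intro prods_add prods_incl upper_elementary lower_elementary C)
    then show ?thesis by (simp only: numeral_3_eq_3 One_nat_def add_Suc add_0)
  qed
  fix x assume "x \<in> carrier ?Q"
  then obtain a b c d where *: "x = mat2 (int l) a b c d" "[a * d - b * c = 1] (mod int l)"
    by (elim carrier_sl2E)
  show "x \<in> prods ?Q ?C 4"
  proof (cases "int l dvd c")
    case False
    then have "x \<in> prods ?Q ?C 3" using 3 * by blast
    then show ?thesis using prods_mono[OF C, of 3 4] by auto
  next
    case True
    have "\<not> int l dvd a"
    proof
      assume "int l dvd a"
      then have "int l dvd a * d - b * c" using True by simp
      then have "int l dvd 1" using *(2) cong_dvd_iff by blast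
      then show False using l by (simp add: prime_nat_iff)
    qed
    then have "\<not> int l dvd a + c" using True by (simp add: dvd_add_left_iff)
    moreover have "[a * (b + d) - b * (a + c) = 1] (mod int l)" using *(2) by (simp add: algebra_simps)
    ultimately have "mat2 (int l) a b (a + c) (b + d) \<in> prods ?Q ?C 3" using 3 by blast
    \<comment> \<open>Left multiplication by this unipotent subtracts the first row from the
      second.\<close>
    then have "mat2 (int l) 1 0 (-1) 1 \<otimes>\<^bsub>?Q\<^esub> mat2 (int l) a b (a + c) (b + d) \<in> prods ?Q ?C (1 + 3)"
      by (intro prods_add prods_incl lower_elementary C)
    moreover have "mat2 (int l) 1 0 (-1) 1 \<otimes>\<^bsub>?Q\<^esub> mat2 (int l) a b (a + c) (b + d) = x"
      unfolding mult_sl2 *(1) by simp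
    ultimately show ?thesis by simp
  qed
qed

text \<open>Conjugation by the diagonal matrix with entries 2 and 1/2 multiplies a unipotent entry
  by 4, so the commutator multiplies it by 3. For \<open>l > 3\<close> both 2 and 3 are invertible,
  and every unipotent is a commutator.\<close>

lemma sl2_perfect:
  assumes l: "Factorial_Ring.prime (l::nat)" "l > 3"
  shows "derived (sl2 (int l)) (carrier (sl2 (int l))) = carrier (sl2 (int l))"
proof
  let ?Q = "sl2 (int l)" and ?m = "mat2 (int l)"
  interpret group ?Q by (rule group_sl2)
  let ?D = "derived ?Q (carrier ?Q)"
  show "?D \<subseteq> carrier ?Q" by (simp add: derived_in_carrier)
  have D: "subgroup ?D ?Q" by (simp add: derived_is_subgroup)
  have nd: "\<not> int l dvd 2" "\<not> int l dvd 3"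
    using l(2) by (auto dest: zdvd_imp_le)
  \<comment> \<open>\<open>h\<close> and \<open>f\<close> are 1/2 and 1/3 modulo \<open>l\<close>;
    the unipotent with entry \<open>f * b\<close> then yields the one with entry
    \<open>b\<close>.\<close>
  obtain h where h: "[2 * h = 1] (mod int l)" using prime_cong_inverse[OF l(1) nd(1)] .
  obtain f where f: "[3 * f = 1] (mod int l)" using prime_cong_inverse[OF l(1) nd(2)] .
  have comm: "x \<otimes>\<^bsub>?Q\<^esub> y \<otimes>\<^bsub>?Q\<^esub> inv\<^bsub>?Q\<^esub> x \<otimes>\<^bsub>?Q\<^esub> inv\<^bsub>?Q\<^esub> y \<in> ?D"
    if "x \<in> carrier ?Q" "y \<in> carrier ?Q" for x y
    unfolding derived_def using that by (intro generate.incl) blast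
  have U: "?m 1 b 0 1 \<in> ?D" for b
  proof -
    have "?m 2 0 0 h \<otimes>\<^bsub>?Q\<^esub> ?m 1 (f * b) 0 1 \<otimes>\<^bsub>?Q\<^esub> inv\<^bsub>?Q\<^esub> ?m 2 0 0 h \<otimes>\<^bsub>?Q\<^esub> inv\<^bsub>?Q\<^esub> ?m 1 (f * b) 0 1 \<in> ?D"
      using h by (intro comm carrier_sl2I) auto
    also have "?m 2 0 0 h \<otimes>\<^bsub>?Q\<^esub> ?m 1 (f * b) 0 1 \<otimes>\<^bsub>?Q\<^esub> inv\<^bsub>?Q\<^esub> ?m 2 0 0 h \<otimes>\<^bsub>?Q\<^esub> inv\<^bsub>?Q\<^esub> ?m 1 (f * b) 0 1
        = ?m (2 * h) (4 * (f * b) - (2 * h) * (f * b)) 0 (2 * h)"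
      using h by (subst (1 2) inv_sl2) (simp_all add: mult_sl2 algebra_simps)
    also have "\<dots> = ?m 1 b 0 1"
    proof (intro mat2_cong h)
      have "[4 * (f * b) - (2 * h) * (f * b) = 4 * (f * b) - 1 * (f * b)] (mod int l)"
        using h by (intro cong_diff cong_mult) auto
      also have "4 * (f * b) - 1 * (f * b) = (3 * f) * b" by simp
      also have "[(3 * f) * b = 1 * b] (mod int l)" using f by (intro cong_mult) auto
      finally show "[4 * (f * b) - (2 * h) * (f * b) = b] (mod int l)" by simp
    qed auto
    finally show ?thesis .
  qed
  \<comment> \<open>Exchanging the diagonal entries makes the factor 4 appear on the lower
    entry.\<close>
  have L: "?m 1 0 b 1 \<in> ?D" for b
  proof -
    have "?m h 0 0 2 \<otimes>\<^bsub>?Q\<^esub> ?m 1 0 (f * b) 1 \<otimes>\<^bsub>?Q\<^esub> inv\<^bsub>?Q\<^esub> ?m h 0 0 2 \<otimes>\<^bsub>?Q\<^esub> inv\<^bsub>?Q\<^esub> ?m 1 0 (f * b) 1 \<in> ?D"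
      using h by (intro comm carrier_sl2I) (auto simp: mult.commute)
    also have "?m h 0 0 2 \<otimes>\<^bsub>?Q\<^esub> ?m 1 0 (f * b) 1 \<otimes>\<^bsub>?Q\<^esub> inv\<^bsub>?Q\<^esub> ?m h 0 0 2 \<otimes>\<^bsub>?Q\<^esub> inv\<^bsub>?Q\<^esub> ?m 1 0 (f * b) 1
        = ?m (2 * h) 0 (4 * (f * b) - (2 * h) * (f * b)) (2 * h)"
      using h by (subst (1 2) inv_sl2) (simp_all add: mult_sl2 algebra_simps)
    also have "\<dots> = ?m 1 0 b 1"
    proof (intro mat2_cong h)
      have "[4 * (f * b) - (2 * h) * (f * b) = 4 * (f * b) - 1 * (f * b)] (mod int l)"
        using h by (intro cong_diff cong_mult) auto
      also have "4 * (f * b) - 1 * (f * b) = (3 * f) * b" by simp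
      also have "[(3 * f) * b = 1 * b] (mod int l)" using f by (intro cong_mult) auto
      finally show "[4 * (f * b) - (2 * h) * (f * b) = b] (mod int l)" by simp
    qed auto
    finally show ?thesis .
  qed
  have "elementary (int l) \<subseteq> ?D"
    using U L by (auto simp: elementary_def)
  then show "carrier ?Q \<subseteq> ?D"
    using sl2_prods_elementary[OF l(1)] prods_subgroup[OF D] by blast
qed

section \<open>Normal closures of perfect subgroups\<close>

lemma (in group_hom) subgroup_vimage:
  assumes "subgroup K H" shows "subgroup {x \<in> carrier G. h x \<in> K} G"
  using assms
  by (intro G.subgroupI)
     (auto intro: subgroup.m_closed subgroup.m_inv_closed subgroup.one_closed intro!: exI[of _ "\<one>"])

lemma (in group_hom) generate_vimage:
  assumes "subgroup K H" "C \<subseteq> carrier G" "h ` C \<subseteq> K" "x \<in> generate G C"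
  shows "h x \<in> K"
proof -
  have "generate G C \<subseteq> {x \<in> carrier G. h x \<in> K}"
    using assms(2,3) by (intro G.generate_subgroup_incl subgroup_vimage[OF assms(1)]) auto
  then show ?thesis using assms(4) by blast
qed

lemma prods_carrier_update: "prods (G\<lparr>carrier := N\<rparr>) C k = prods G C k"
  by (induction k) (simp_all add: set_mult_def)

lemma nat_pow_carrier_update: "x [^]\<^bsub>G\<lparr>carrier := N\<rparr>\<^esub> (k::nat) = x [^]\<^bsub>G\<^esub> k"
  by (simp add: nat_pow_def)

lemma prods_mono_set: "C \<subseteq> D \<Longrightarrow> prods G C k \<subseteq> prods G D k"
  by (induction k) (auto simp: set_mult_def)

lemma prods_image:
  assumes "group_hom G H h" "C \<subseteq> carrier G"
  shows "h ` prods G C k = prods H (h ` C) k"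
proof -
  interpret group_hom G H h by fact
  have "h ` (A <#>\<^bsub>G\<^esub> B) = h ` A <#>\<^bsub>H\<^esub> h ` B" if "A \<subseteq> carrier G" "B \<subseteq> carrier G" for A B
    using that by (force simp: set_mult_def image_iff)
  then show ?thesis using assms(2) by (induction k) (simp_all add: G.prods_carrier)
qed

context group
begin

lemma hom_conj: "k \<in> carrier G \<Longrightarrow> group_hom G G (\<lambda>x. k \<otimes> x \<otimes> inv k)"
  by (intro group_hom.intro group_hom_axioms.intro homI is_group) (simp_all add: m_assoc, simp add: m_assoc[symmetric])

definition normal_closure :: "'a set \<Rightarrow> 'a set" where
  "normal_closure H = generate G (\<Union>k\<in>carrier G. (\<lambda>x. k \<otimes> x \<otimes> inv k) ` H)"

lemma normal_closure_subgroup: "H \<subseteq> carrier G \<Longrightarrow> subgroup (normal_closure H) G"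
  unfolding normal_closure_def by (intro generate_is_subgroup) auto

lemma normal_closure_conj:
  "h \<in> H \<Longrightarrow> k \<in> carrier G \<Longrightarrow> k \<otimes> h \<otimes> inv k \<in> normal_closure H"
  unfolding normal_closure_def by (intro generate.incl) auto

lemma normal_closure_incl: "H \<subseteq> carrier G \<Longrightarrow> H \<subseteq> normal_closure H"
  using normal_closure_conj[of _ H \<one>] by force

lemma normal_closure_subset:
  assumes "subgroup K G" "\<And>h k. h \<in> H \<Longrightarrow> k \<in> carrier G \<Longrightarrow> k \<otimes> h \<otimes> inv k \<in> K"
  shows "normal_closure H \<subseteq> K"
  unfolding normal_closure_def using assms by (intro generate_subgroup_incl) auto

text \<open>Each conjugate of \<open>H\<close> is its own derived subgroup, hence lies in the
  derived subgroup of the normal closure, and the conjugates generate the closure.\<close>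

lemma normal_closure_perfect:
  assumes "H \<subseteq> carrier G" "derived G H = H"
  shows "derived G (normal_closure H) = normal_closure H"
proof
  let ?N = "normal_closure H"
  note N = normal_closure_subgroup[OF assms(1)]
  show "derived G ?N \<subseteq> ?N" using derived_incl[OF _ N] by blast
  have Nc: "?N \<subseteq> carrier G" using N by (rule subgroup.subset)
  show "?N \<subseteq> derived G ?N"
  proof (rule normal_closure_subset[OF derived_is_subgroup[OF Nc]])
    fix h k assume h: "h \<in> H" and k: "k \<in> carrier G"
    interpret c: group_hom G G "\<lambda>x. k \<otimes> x \<otimes> inv k" by (rule hom_conj[OF k])
    have "(\<lambda>x. k \<otimes> x \<otimes> inv k) ` derived G H = derived G ((\<lambda>x. k \<otimes> x \<otimes> inv k) ` H)"
      by (rule c.derived_img[OF assms(1), symmetric])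
    also have "\<dots> \<subseteq> derived G ?N"
      by (rule mono_derived) (use k normal_closure_conj in auto)
    finally show "k \<otimes> h \<otimes> inv k \<in> derived G ?N" using assms(2) h by auto
  qed
qed

text \<open>Conjugates of \<open>l\<close>-torsion elements are \<open>l\<close>-torsion, so they
  are \<open>m\<close>-th powers inside the normal closure, which they generate.\<close>

lemma normal_closure_power_subgroup:
  assumes H: "H \<subseteq> carrier G" "H \<subseteq> generate G (torsion G l \<inter> H)" and "coprime m l"
  shows "power_subgroup (G\<lparr>carrier := normal_closure H\<rparr>) m = normal_closure H"
proof
  let ?N = "normal_closure H"
  let ?G = "G\<lparr>carrier := normal_closure H\<rparr>"
  note N = normal_closure_subgroup[OF H(1)]
  interpret N: group ?G by (rule subgroup_imp_group[OF N])
  show "power_subgroup ?G m \<subseteq> ?N"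
    using subgroup.subset[OF N.subgroup_power_subgroup] by simp
  have S: "subgroup (power_subgroup ?G m) G"
    using incl_subgroup[OF N N.subgroup_power_subgroup] .
  show "?N \<subseteq> power_subgroup ?G m"
  proof (rule normal_closure_subset[OF S])
    fix h k assume h: "h \<in> H" and k: "k \<in> carrier G"
    interpret c: group_hom G G "\<lambda>x. k \<otimes> x \<otimes> inv k" by (rule hom_conj[OF k])
    have "k \<otimes> x \<otimes> inv k \<in> power_subgroup ?G m" if x: "x \<in> torsion G l" "x \<in> H" for x
    proof -
      have "k \<otimes> x \<otimes> inv k \<in> ?N" using normal_closure_conj[OF x(2) k] .
      moreover have "(k \<otimes> x \<otimes> inv k) [^] l = \<one>"
        using c.hom_nat_pow[of x l] x(1) k by (auto simp: torsion_def)
      ultimately have "k \<otimes> x \<otimes> inv k \<in> powers ?G m"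
        using N.mem_powers_coprime[of "k \<otimes> x \<otimes> inv k" l m] assms(3) by (simp add: nat_pow_carrier_update)
      then show ?thesis unfolding power_subgroup_eq by (rule generate.incl)
    qed
    then show "k \<otimes> h \<otimes> inv k \<in> power_subgroup ?G m"
      using h H by (intro c.generate_vimage[OF S, of "torsion G l \<inter> H"]) auto
  qed
qed

text \<open>Commutators depend only on cosets of a central subgroup; this keeps the number of verbal
  values small in the counting argument.\<close>

lemma commutator_central:
  assumes "x \<in> carrier G" "y \<in> carrier G" "c \<in> carrier G" "d \<in> carrier G"
    and "\<And>x. x \<in> carrier G \<Longrightarrow> c \<otimes> x = x \<otimes> c" "\<And>x. x \<in> carrier G \<Longrightarrow> d \<otimes> x = x \<otimes> d"
  shows "(x \<otimes> c) \<otimes> (y \<otimes> d) \<otimes> inv (x \<otimes> c) \<otimes> inv (y \<otimes> d) = x \<otimes> y \<otimes> inv x \<otimes> inv y"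
proof -
  \<comment> \<open>Written as a quotient of the products in the two orders, the commutator shows
    both central factors next to their inverses.\<close>
  have *: "u \<otimes> v \<otimes> inv u \<otimes> inv v = (u \<otimes> v) \<otimes> inv (v \<otimes> u)"
    if "u \<in> carrier G" "v \<in> carrier G" for u v
    using that by (simp add: inv_mult_group m_assoc)
  have "(x \<otimes> c) \<otimes> (y \<otimes> d) = x \<otimes> (c \<otimes> y) \<otimes> d" using assms(1-4) by (simp add: m_assoc)
  also have "\<dots> = (x \<otimes> y) \<otimes> (c \<otimes> d)" using assms(1-4) by (simp add: assms(5) m_assoc)
  finally have 1: "(x \<otimes> c) \<otimes> (y \<otimes> d) = (x \<otimes> y) \<otimes> (c \<otimes> d)" .
  have "(y \<otimes> d) \<otimes> (x \<otimes> c) = y \<otimes> (d \<otimes> x) \<otimes> c" using assms(1-4) by (simp add: m_assoc)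
  also have "\<dots> = y \<otimes> x \<otimes> (d \<otimes> c)" using assms(1-4) by (simp add: assms(6) m_assoc)
  finally have 2: "(y \<otimes> d) \<otimes> (x \<otimes> c) = (y \<otimes> x) \<otimes> (c \<otimes> d)" using assms(4,5) by simp
  have "(x \<otimes> c) \<otimes> (y \<otimes> d) \<otimes> inv (x \<otimes> c) \<otimes> inv (y \<otimes> d)
      = ((x \<otimes> y) \<otimes> (c \<otimes> d)) \<otimes> inv ((y \<otimes> x) \<otimes> (c \<otimes> d))"
    using *[of "x \<otimes> c" "y \<otimes> d"] assms(1-4) unfolding 1 2 by simp
  also have "\<dots> = (x \<otimes> y) \<otimes> ((c \<otimes> d) \<otimes> inv (c \<otimes> d)) \<otimes> inv (y \<otimes> x)"
    using assms(1-4) by (simp add: inv_mult_group m_assoc del: r_inv)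
  also have "\<dots> = x \<otimes> y \<otimes> inv x \<otimes> inv y"
    using assms(1-4) * by simp
  finally show ?thesis .
qed

lemma finite_card_prods:
  assumes "finite C" shows "finite (prods G C k) \<and> card (prods G C k) \<le> card C ^ k"
proof (induction k)
  case (Suc k)
  have eq: "prods G C (Suc k) = (\<lambda>(x, y). x \<otimes> y) ` (prods G C k \<times> C)"
    by (auto simp: set_mult_def)
  have "card (prods G C (Suc k)) \<le> card (prods G C k \<times> C)"
    unfolding eq using Suc assms by (intro card_image_le) auto
  also have "\<dots> \<le> card C ^ k * card C" using Suc by (simp add: card_cartesian_product)
  finally show ?case using Suc assms unfolding eq by (simp add: mult.commute)
qed auto

end

section \<open>A class two extension\<close>

text \<open>A bilinear map is a 2-cocycle, so \<open>\<beta>\<close> turns the pairs from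
  \<open>A\<close> and \<open>Z\<close> into a central extension of \<open>A\<close> by
  \<open>Z\<close>. Invariance lets \<open>Q\<close> act on it, trivially on \<open>Z\<close>, and
  \<open>ext\<close> is the semidirect product.\<close>

locale bilinear_extension = Q: group Q + A: comm_group A + Z: comm_group Z
  for Q :: "('q, 'm) monoid_scheme" and A :: "('a, 'n) monoid_scheme" and Z :: "('z, 'o) monoid_scheme" +
  fixes act :: "'q \<Rightarrow> 'a \<Rightarrow> 'a" and \<beta> :: "'a \<Rightarrow> 'a \<Rightarrow> 'z"
  assumes act_closed: "g \<in> carrier Q \<Longrightarrow> a \<in> carrier A \<Longrightarrow> act g a \<in> carrier A"
    and act_mult: "g \<in> carrier Q \<Longrightarrow> a \<in> carrier A \<Longrightarrow> b \<in> carrier A \<Longrightarrow>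
      act g (a \<otimes>\<^bsub>A\<^esub> b) = act g a \<otimes>\<^bsub>A\<^esub> act g b"
    and act_one: "a \<in> carrier A \<Longrightarrow> act \<one>\<^bsub>Q\<^esub> a = a"
    and act_act: "g \<in> carrier Q \<Longrightarrow> h \<in> carrier Q \<Longrightarrow> a \<in> carrier A \<Longrightarrow>
      act (g \<otimes>\<^bsub>Q\<^esub> h) a = act g (act h a)"
    and form_closed: "a \<in> carrier A \<Longrightarrow> b \<in> carrier A \<Longrightarrow> \<beta> a b \<in> carrier Z"
    and form_mult_left: "a \<in> carrier A \<Longrightarrow> b \<in> carrier A \<Longrightarrow> c \<in> carrier A \<Longrightarrow>
      \<beta> (a \<otimes>\<^bsub>A\<^esub> b) c = \<beta> a c \<otimes>\<^bsub>Z\<^esub> \<beta> b c"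
    and form_mult_right: "a \<in> carrier A \<Longrightarrow> b \<in> carrier A \<Longrightarrow> c \<in> carrier A \<Longrightarrow>
      \<beta> a (b \<otimes>\<^bsub>A\<^esub> c) = \<beta> a b \<otimes>\<^bsub>Z\<^esub> \<beta> a c"
    and form_act: "g \<in> carrier Q \<Longrightarrow> a \<in> carrier A \<Longrightarrow> b \<in> carrier A \<Longrightarrow>
      \<beta> (act g a) (act g b) = \<beta> a b"
begin

definition ext :: "('a \<times> 'z \<times> 'q) monoid" where
  "ext = \<lparr>carrier = carrier A \<times> carrier Z \<times> carrier Q,
     monoid.mult = (\<lambda>(a, z, g) (b, w, h).
       (a \<otimes>\<^bsub>A\<^esub> act g b, z \<otimes>\<^bsub>Z\<^esub> w \<otimes>\<^bsub>Z\<^esub> \<beta> a (act g b), g \<otimes>\<^bsub>Q\<^esub> h)),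
     one = (\<one>\<^bsub>A\<^esub>, \<one>\<^bsub>Z\<^esub>, \<one>\<^bsub>Q\<^esub>)\<rparr>"

lemma ext_simps:
  "carrier ext = carrier A \<times> carrier Z \<times> carrier Q"
  "(a, z, g) \<otimes>\<^bsub>ext\<^esub> (b, w, h) =
     (a \<otimes>\<^bsub>A\<^esub> act g b, z \<otimes>\<^bsub>Z\<^esub> w \<otimes>\<^bsub>Z\<^esub> \<beta> a (act g b), g \<otimes>\<^bsub>Q\<^esub> h)"
  "\<one>\<^bsub>ext\<^esub> = (\<one>\<^bsub>A\<^esub>, \<one>\<^bsub>Z\<^esub>, \<one>\<^bsub>Q\<^esub>)"
  by (simp_all add: ext_def)

lemma hom_act: "g \<in> carrier Q \<Longrightarrow> group_hom A A (act g)"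
  by (intro group_hom.intro group_hom_axioms.intro homI A.is_group) (simp_all add: act_closed act_mult)

lemma hom_form_left: "b \<in> carrier A \<Longrightarrow> group_hom A Z (\<lambda>a. \<beta> a b)"
  by (intro group_hom.intro group_hom_axioms.intro homI A.is_group Z.is_group) (simp_all add: form_closed form_mult_left)

lemma hom_form_right: "a \<in> carrier A \<Longrightarrow> group_hom A Z (\<beta> a)"
  by (intro group_hom.intro group_hom_axioms.intro homI A.is_group Z.is_group) (simp_all add: form_closed form_mult_right)

lemmas hom_simps =
  group_hom.hom_one[OF hom_act] group_hom.hom_one[OF hom_form_left] group_hom.hom_one[OF hom_form_right]
  group_hom.hom_inv[OF hom_act] group_hom.hom_inv[OF hom_form_left] group_hom.hom_inv[OF hom_form_right]

lemmas closed = act_closed form_closed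

lemma group_ext: "group ext"
proof (rule groupI)
  fix x y assume "x \<in> carrier ext" "y \<in> carrier ext"
  then show "x \<otimes>\<^bsub>ext\<^esub> y \<in> carrier ext"
    by (auto simp: ext_simps closed)
next
  show "\<one>\<^bsub>ext\<^esub> \<in> carrier ext" by (simp add: ext_simps)
next
  fix x y z assume "x \<in> carrier ext" "y \<in> carrier ext" "z \<in> carrier ext"
  then show "x \<otimes>\<^bsub>ext\<^esub> y \<otimes>\<^bsub>ext\<^esub> z = x \<otimes>\<^bsub>ext\<^esub> (y \<otimes>\<^bsub>ext\<^esub> z)"
    by (auto simp: ext_simps closed act_mult act_act form_mult_left form_mult_right form_act
        A.m_assoc Z.m_ac Q.m_assoc)
next
  fix x assume "x \<in> carrier ext"
  then show "\<one>\<^bsub>ext\<^esub> \<otimes>\<^bsub>ext\<^esub> x = x"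
    by (auto simp: ext_simps closed act_one hom_simps)
next
  fix x assume "x \<in> carrier ext"
  then obtain a z g where x: "x = (a, z, g)" "a \<in> carrier A" "z \<in> carrier Z" "g \<in> carrier Q"
    by (auto simp: ext_simps)
  \<comment> \<open>The summand \<open>\<beta> a a\<close> compensates the twist of the product,
    which by invariance equals the inverse of \<open>\<beta> a a\<close>.\<close>
  let ?y = "(inv\<^bsub>A\<^esub> act (inv\<^bsub>Q\<^esub> g) a, inv\<^bsub>Z\<^esub> z \<otimes>\<^bsub>Z\<^esub> \<beta> a a, inv\<^bsub>Q\<^esub> g)"
  have "?y \<in> carrier ext" using x by (auto simp: ext_simps closed)
  moreover have "?y \<otimes>\<^bsub>ext\<^esub> x = \<one>\<^bsub>ext\<^esub>"
  proof -
    have "inv\<^bsub>Z\<^esub> z \<otimes>\<^bsub>Z\<^esub> \<beta> a a \<otimes>\<^bsub>Z\<^esub> z \<otimes>\<^bsub>Z\<^esub> inv\<^bsub>Z\<^esub> \<beta> a a = \<one>\<^bsub>Z\<^esub>"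
      using x by (simp add: closed Z.inv_solve_right' Z.m_comm Z.m_lcomm)
    then show ?thesis using x by (simp add: ext_simps closed hom_simps form_act)
  qed
  ultimately show "\<exists>y\<in>carrier ext. y \<otimes>\<^bsub>ext\<^esub> x = \<one>\<^bsub>ext\<^esub>" by blast
qed

sublocale E: group ext by (rule group_ext)

section \<open>The copies of \<open>Q\<close> and \<open>Z\<close>, and the normal closure of
  \<open>Q\<close>\<close>

definition quo :: "'q \<Rightarrow> 'a \<times> 'z \<times> 'q" where "quo g = (\<one>\<^bsub>A\<^esub>, \<one>\<^bsub>Z\<^esub>, g)"

definition cen :: "'z \<Rightarrow> 'a \<times> 'z \<times> 'q" where "cen z = (\<one>\<^bsub>A\<^esub>, z, \<one>\<^bsub>Q\<^esub>)"

sublocale quo: group_hom Q ext quo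
  by (intro group_hom.intro group_hom_axioms.intro homI Q.is_group E.is_group)
     (auto simp: ext_simps quo_def closed hom_simps)

sublocale cen: group_hom Z ext cen
  by (intro group_hom.intro group_hom_axioms.intro homI Z.is_group E.is_group)
     (auto simp: ext_simps cen_def closed hom_simps act_one)

lemma cen_central: "z \<in> carrier Z \<Longrightarrow> x \<in> carrier ext \<Longrightarrow> cen z \<otimes>\<^bsub>ext\<^esub> x = x \<otimes>\<^bsub>ext\<^esub> cen z"
  by (auto simp: ext_simps cen_def closed hom_simps act_one Z.m_comm)

lemma ext_split: "a \<in> carrier A \<Longrightarrow> z \<in> carrier Z \<Longrightarrow> g \<in> carrier Q \<Longrightarrow>
    (a, z, g) = (a, \<one>\<^bsub>Z\<^esub>, g) \<otimes>\<^bsub>ext\<^esub> cen z"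
  by (auto simp: ext_simps cen_def closed hom_simps)

lemma quo_closed: "g \<in> carrier Q \<Longrightarrow> quo g \<in> carrier ext" and quo_image: "quo ` carrier Q \<subseteq> carrier ext"
  using quo.hom_closed by auto

text \<open>This becomes the factor \<open>L n\<close>. The whole extension need not be perfect,
  whereas the normal closure of a perfect subgroup is.\<close>

definition core :: "('a \<times> 'z \<times> 'q) set" where
  "core = E.normal_closure (quo ` carrier Q)"

definition core_group :: "('a \<times> 'z \<times> 'q) monoid" where
  "core_group = ext\<lparr>carrier := core\<rparr>"

lemma core_subgroup: "subgroup core ext"
  unfolding core_def by (rule E.normal_closure_subgroup) auto

lemma core_carrier: "core \<subseteq> carrier ext"
  using core_subgroup by (rule subgroup.subset)

lemma group_core: "group core_group"
  unfolding core_group_def by (rule E.subgroup_imp_group[OF core_subgroup])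

lemma quo_core: "g \<in> carrier Q \<Longrightarrow> quo g \<in> core"
  unfolding core_def using E.normal_closure_incl[OF quo_image] by blast

lemma coreE:
  assumes "x \<in> core"
  obtains a z g where "x = (a, z, g)" "a \<in> carrier A" "z \<in> carrier Z" "g \<in> carrier Q"
proof -
  have "x \<in> carrier A \<times> carrier Z \<times> carrier Q"
    using assms core_carrier unfolding ext_simps(1) by blast
  then show thesis using that by auto
qed

lemma derived_core:
  assumes "derived Q (carrier Q) = carrier Q"
  shows "derived core_group (carrier core_group) = carrier core_group"
proof -
  have "derived ext core = core"
    unfolding core_def
    by (rule E.normal_closure_perfect) (use quo.derived_img[of "carrier Q"] assms in auto)
  then show ?thesis
    using E.derived_consistent[OF subset_refl core_subgroup] by (simp add: core_group_def)
qed

lemma power_subgroup_core: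
  assumes "carrier Q \<subseteq> prods Q (torsion Q l) k" "coprime m l"
  shows "power_subgroup core_group m = carrier core_group"
proof -
  have T: "torsion Q l \<subseteq> carrier Q" by (auto simp: torsion_def)
  have "quo ` torsion Q l \<subseteq> torsion ext l \<inter> quo ` carrier Q"
    by (auto simp: torsion_def simp flip: quo.hom_nat_pow)
  then have "generate ext (quo ` torsion Q l) \<subseteq> generate ext (torsion ext l \<inter> quo ` carrier Q)"
    by (rule E.mono_generate)
  moreover have "quo ` carrier Q \<subseteq> prods ext (quo ` torsion Q l) k"
    using assms(1) prods_image[OF quo.group_hom_axioms T, of k] by blast
  moreover have "prods ext (quo ` torsion Q l) k \<subseteq> generate ext (quo ` torsion Q l)"
    using T by (intro E.prods_subgroup E.generate_is_subgroup) (auto intro: generate.incl)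
  ultimately have "quo ` carrier Q \<subseteq> generate ext (torsion ext l \<inter> quo ` carrier Q)" by blast
  then show ?thesis
    using E.normal_closure_power_subgroup[OF quo_image _ assms(2)]
    by (simp add: core_group_def core_def)
qed

lemma kernel_pow:
  assumes "a \<in> carrier A" "z \<in> carrier Z"
  shows "\<exists>w\<in>carrier Z. (a, z, \<one>\<^bsub>Q\<^esub>) [^]\<^bsub>ext\<^esub> (n::nat) = (a [^]\<^bsub>A\<^esub> n, w, \<one>\<^bsub>Q\<^esub>)"
proof (induction n)
  case 0
  show ?case by (auto simp: ext_simps)
next
  case (Suc n)
  then show ?case using assms by (auto simp: ext_simps closed act_one)
qed

text \<open>The \<open>p\<close>-th power lands in the central copy of \<open>Z\<close>, which has
  exponent \<open>p\<close>. The exponent \<open>p * p\<close> covers \<open>p = 2\<close>, where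
  the square is \<open>\<beta> a a\<close> in the centre and may be nontrivial.\<close>

lemma kernel_torsion:
  assumes "a \<in> carrier A" "z \<in> carrier Z" "a [^]\<^bsub>A\<^esub> (p::nat) = \<one>\<^bsub>A\<^esub>"
    "\<And>z. z \<in> carrier Z \<Longrightarrow> z [^]\<^bsub>Z\<^esub> (p::nat) = \<one>\<^bsub>Z\<^esub>"
  shows "(a, z, \<one>\<^bsub>Q\<^esub>) [^]\<^bsub>ext\<^esub> (p * p) = \<one>\<^bsub>ext\<^esub>"
proof -
  have x: "(a, z, \<one>\<^bsub>Q\<^esub>) \<in> carrier ext" using assms by (simp add: ext_simps)
  obtain w where w: "w \<in> carrier Z" "(a, z, \<one>\<^bsub>Q\<^esub>) [^]\<^bsub>ext\<^esub> p = cen w"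
    using kernel_pow[OF assms(1,2), of p] assms(3) by (auto simp: cen_def)
  have "(a, z, \<one>\<^bsub>Q\<^esub>) [^]\<^bsub>ext\<^esub> (p * p) = cen w [^]\<^bsub>ext\<^esub> p"
    using x w by (simp flip: E.nat_pow_pow)
  also have "\<dots> = \<one>\<^bsub>ext\<^esub>" using w(1) assms(4) by (simp flip: cen.hom_nat_pow)
  finally show ?thesis .
qed

text \<open>An element splits into a kernel part, which is one \<open>m\<close>-th power because its
  order divides \<open>p * p\<close>, and an element of \<open>Q\<close>, which is a product of
  \<open>k\<close> elements of order dividing \<open>l\<close>, each an \<open>m\<close>-th
  power.\<close>

lemma core_prods_powers:
  assumes Q: "carrier Q \<subseteq> prods Q (torsion Q l) k"
    and A: "\<And>a. a \<in> carrier A \<Longrightarrow> a [^]\<^bsub>A\<^esub> (p::nat) = \<one>\<^bsub>A\<^esub>"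
    and Z: "\<And>z. z \<in> carrier Z \<Longrightarrow> z [^]\<^bsub>Z\<^esub> (p::nat) = \<one>\<^bsub>Z\<^esub>"
    and m: "coprime m l" "coprime m p"
  shows "carrier core_group \<subseteq> prods core_group (powers core_group m) (Suc k)"
proof
  interpret C: group core_group by (rule group_core)
  have T: "torsion Q l \<subseteq> carrier Q" by (auto simp: torsion_def)
  fix x assume "x \<in> carrier core_group"
  then have x: "x \<in> core" by (simp add: core_group_def)
  then obtain a z g where *: "x = (a, z, g)" "a \<in> carrier A" "z \<in> carrier Z" "g \<in> carrier Q"
    by (elim coreE)
  have eq: "x = (a, z, \<one>\<^bsub>Q\<^esub>) \<otimes>\<^bsub>ext\<^esub> quo g"
    using * by (simp add: ext_simps quo_def closed hom_simps)
  have cx: "(a, z, \<one>\<^bsub>Q\<^esub>) \<in> carrier ext" "quo g \<in> carrier ext"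
    using * quo_closed by (auto simp: ext_simps(1))
  have "(a, z, \<one>\<^bsub>Q\<^esub>) = x \<otimes>\<^bsub>ext\<^esub> inv\<^bsub>ext\<^esub> quo g"
    unfolding eq using cx by (simp add: E.m_assoc)
  \<comment> \<open>The kernel part has to lie in the core for its \<open>m\<close>-th root to lie
    there too.\<close>
  then have "(a, z, \<one>\<^bsub>Q\<^esub>) \<in> core"
    using subgroup.m_closed[OF core_subgroup x] subgroup.m_inv_closed[OF core_subgroup quo_core[OF *(4)]] by simp
  moreover have "(a, z, \<one>\<^bsub>Q\<^esub>) [^]\<^bsub>ext\<^esub> (p * p) = \<one>\<^bsub>ext\<^esub>"
    using * A Z by (intro kernel_torsion)
  ultimately have 1: "(a, z, \<one>\<^bsub>Q\<^esub>) \<in> powers core_group m"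
    using m(2) by (intro C.mem_powers_coprime[where k = "p * p"])
      (simp_all add: core_group_def nat_pow_carrier_update)
  have "quo g \<in> prods ext (quo ` torsion Q l) k"
    using Q *(4) prods_image[OF quo.group_hom_axioms T, of k] by blast
  moreover have "quo ` torsion Q l \<subseteq> powers core_group m"
  proof
    fix y assume "y \<in> quo ` torsion Q l"
    then obtain t where t: "y = quo t" "t \<in> carrier Q" "t [^]\<^bsub>Q\<^esub> l = \<one>\<^bsub>Q\<^esub>" by (auto simp: torsion_def)
    then have "y [^]\<^bsub>ext\<^esub> l = \<one>\<^bsub>ext\<^esub>" by (simp flip: quo.hom_nat_pow)
    then show "y \<in> powers core_group m"
      using m(1) t quo_core by (intro C.mem_powers_coprime[where k = l])
        (simp_all add: core_group_def nat_pow_carrier_update)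
  qed
  ultimately have 2: "quo g \<in> prods core_group (powers core_group m) k"
    using prods_mono_set[of "quo ` torsion Q l" "powers core_group m" ext k]
    by (auto simp: core_group_def prods_carrier_update)
  have "(a, z, \<one>\<^bsub>Q\<^esub>) \<otimes>\<^bsub>core_group\<^esub> quo g \<in> prods core_group (powers core_group m) (1 + k)"
    using 1 2 by (intro C.prods_add C.prods_incl C.powers_carrier)
  then show "x \<in> prods core_group (powers core_group m) (Suc k)"
    unfolding eq by (simp add: core_group_def)
qed

section \<open>Central elements of the core\<close>

lemma commutator_core:
  assumes "a \<in> carrier A" "g \<in> carrier Q"
  shows "\<exists>z\<in>carrier Z. (a \<otimes>\<^bsub>A\<^esub> inv\<^bsub>A\<^esub> act g a, z, \<one>\<^bsub>Q\<^esub>) \<in> core"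
proof -
  let ?k = "(a, \<one>\<^bsub>Z\<^esub>, \<one>\<^bsub>Q\<^esub>)"
  have k: "?k \<in> carrier ext" using assms by (simp add: ext_simps)
  \<comment> \<open>Only the coordinates of the inverse in \<open>A\<close> and \<open>Q\<close> get
    computed; the central one stays an unknown \<open>w\<close>.\<close>
  let ?y = "inv\<^bsub>ext\<^esub> ?k"
  have "?y \<in> carrier ext" using k by simp
  then obtain b w h where y: "?y = (b, w, h)" "b \<in> carrier A" "w \<in> carrier Z" "h \<in> carrier Q"
    by (auto simp: ext_simps)
  have "?k \<otimes>\<^bsub>ext\<^esub> ?y = \<one>\<^bsub>ext\<^esub>" using k by simp
  then have bh: "a \<otimes>\<^bsub>A\<^esub> b = \<one>\<^bsub>A\<^esub>" "h = \<one>\<^bsub>Q\<^esub>"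
    using y assms by (auto simp: ext_simps act_one)
  then have b: "b = inv\<^bsub>A\<^esub> a" using y assms by (metis A.comm_inv_char A.inv_unique' A.m_comm)
  \<comment> \<open>\<open>?k\<close> itself need not lie in the core, but its conjugate of
    \<open>quo g\<close> does, and so does the commutator of the two.\<close>
  have "?k \<otimes>\<^bsub>ext\<^esub> quo g \<otimes>\<^bsub>ext\<^esub> ?y \<in> core"
    unfolding core_def using assms k by (intro E.normal_closure_conj) auto
  then have "?k \<otimes>\<^bsub>ext\<^esub> quo g \<otimes>\<^bsub>ext\<^esub> ?y \<otimes>\<^bsub>ext\<^esub> quo (inv\<^bsub>Q\<^esub> g) \<in> core"
    using quo_core[of "inv\<^bsub>Q\<^esub> g"] assms(2) subgroup.m_closed[OF core_subgroup] by simp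
  then show ?thesis
    using assms y(2-) unfolding y(1) quo_def b bh
    by (auto simp: ext_simps closed hom_simps act_one simp del: group_hom.hom_inv)
qed

text \<open>The commutator of a vector \<open>a\<close> with \<open>g \<in> Q\<close> is, up to the center, \<open>a - g a\<close>; the commutators of two
  such elements then produce central elements of the core.\<close>

definition displacements :: "'a set" where
  "displacements = (\<Union>g\<in>carrier Q. \<Union>a\<in>carrier A. {a \<otimes>\<^bsub>A\<^esub> inv\<^bsub>A\<^esub> act g a})"

definition brackets :: "'z set" where
  "brackets = (\<Union>c\<in>displacements. \<Union>d\<in>displacements. {\<beta> c d \<otimes>\<^bsub>Z\<^esub> inv\<^bsub>Z\<^esub> \<beta> d c})"

lemma displacements_carrier: "displacements \<subseteq> carrier A"
  by (auto simp: displacements_def closed)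

lemma brackets_carrier: "brackets \<subseteq> carrier Z"
  using displacements_carrier unfolding brackets_def by (auto intro!: closed Z.m_closed Z.inv_closed)

lemma displacementsI:
  "g \<in> carrier Q \<Longrightarrow> a \<in> carrier A \<Longrightarrow> a \<otimes>\<^bsub>A\<^esub> inv\<^bsub>A\<^esub> act g a \<in> displacements"
  by (auto simp: displacements_def)

lemma bracketsI:
  "c \<in> displacements \<Longrightarrow> d \<in> displacements \<Longrightarrow> \<beta> c d \<otimes>\<^bsub>Z\<^esub> inv\<^bsub>Z\<^esub> \<beta> d c \<in> brackets"
  by (auto simp: brackets_def)

text \<open>Two core elements over the vectors \<open>c\<close> and \<open>d\<close> have the
  bracket of \<open>c\<close> and \<open>d\<close> as commutator, since their unknown central parts
  cancel.\<close>

lemma cen_core: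
  assumes gen: "carrier Z \<subseteq> generate Z brackets" and z: "z \<in> carrier Z"
  shows "cen z \<in> core"
proof (rule cen.generate_vimage[OF core_subgroup brackets_carrier])
  show "z \<in> generate Z brackets" using gen z by blast
  show "cen ` brackets \<subseteq> core"
  proof
    fix x assume "x \<in> cen ` brackets"
    then obtain c d where x: "x = cen (\<beta> c d \<otimes>\<^bsub>Z\<^esub> inv\<^bsub>Z\<^esub> \<beta> d c)"
      and c: "c \<in> displacements" and d: "d \<in> displacements"
      by (auto simp: brackets_def)
    have cd: "c \<in> carrier A" "d \<in> carrier A" using c d displacements_carrier by blast+
    obtain u where u: "u \<in> carrier Z" "(c, u, \<one>\<^bsub>Q\<^esub>) \<in> core" using c commutator_core by (auto simp: displacements_def)
    obtain v where v: "v \<in> carrier Z" "(d, v, \<one>\<^bsub>Q\<^esub>) \<in> core" using d commutator_core by (auto simp: displacements_def)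
    let ?x = "(c, u, \<one>\<^bsub>Q\<^esub>)" and ?y = "(d, v, \<one>\<^bsub>Q\<^esub>)"
    have xy: "?x \<in> carrier ext" "?y \<in> carrier ext" using u v core_carrier by auto
    let ?w = "\<beta> c d \<otimes>\<^bsub>Z\<^esub> inv\<^bsub>Z\<^esub> \<beta> d c"
    have w: "?w \<in> carrier Z" using cd by (simp add: closed)
    have eq: "?w \<otimes>\<^bsub>Z\<^esub> \<beta> d c = \<beta> c d" using cd by (simp add: closed Z.m_assoc)
    \<comment> \<open>Comparing the products in both orders avoids computing inverses in
      \<open>ext\<close>.\<close>
    have "cen ?w \<otimes>\<^bsub>ext\<^esub> (?y \<otimes>\<^bsub>ext\<^esub> ?x) = ?x \<otimes>\<^bsub>ext\<^esub> ?y"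
    proof -
      have "?w \<otimes>\<^bsub>Z\<^esub> (v \<otimes>\<^bsub>Z\<^esub> u \<otimes>\<^bsub>Z\<^esub> \<beta> d c) = u \<otimes>\<^bsub>Z\<^esub> v \<otimes>\<^bsub>Z\<^esub> (?w \<otimes>\<^bsub>Z\<^esub> \<beta> d c)"
        using cd u v w by (simp add: closed Z.m_ac)
      then show ?thesis using cd u v w
        by (simp add: cen_def ext_simps closed act_one hom_simps A.m_comm eq)
    qed
    then have "cen ?w = (?x \<otimes>\<^bsub>ext\<^esub> ?y) \<otimes>\<^bsub>ext\<^esub> inv\<^bsub>ext\<^esub> (?y \<otimes>\<^bsub>ext\<^esub> ?x)"
      using xy w E.inv_solve_right[of "cen ?w" "?x \<otimes>\<^bsub>ext\<^esub> ?y" "?y \<otimes>\<^bsub>ext\<^esub> ?x"] by simp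
    also have "\<dots> \<in> core"
      using u v by (intro subgroup.m_closed[OF core_subgroup] subgroup.m_inv_closed[OF core_subgroup])
    finally show "x \<in> core" unfolding x .
  qed
qed

text \<open>Commutators ignore central factors, and so do \<open>p\<close>-th powers because
  \<open>Z\<close> has exponent \<open>p\<close>. Hence all values come from representatives modulo
  \<open>Z\<close>: pairs of them for commutators, single ones for powers.\<close>

lemma card_verbal_core:
  assumes fin: "finite (carrier A)" "finite (carrier Q)"
    and Z: "\<And>z. z \<in> carrier Z \<Longrightarrow> z [^]\<^bsub>Z\<^esub> (p::nat) = \<one>\<^bsub>Z\<^esub>"
  shows "finite (verbal core_group p)"
    "card (verbal core_group p) \<le> 2 * (card (carrier A) * card (carrier Q))\<^sup>2"
proof -
  \<comment> \<open>Representatives with trivial central coordinate may lie outside the core, so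
    values are computed in \<open>ext\<close>.\<close>
  let ?B = "(\<lambda>(a, g). (a, \<one>\<^bsub>Z\<^esub>, g)) ` (carrier A \<times> carrier Q)"
  let ?c = "\<lambda>(x, y). x \<otimes>\<^bsub>ext\<^esub> y \<otimes>\<^bsub>ext\<^esub> inv\<^bsub>ext\<^esub> x \<otimes>\<^bsub>ext\<^esub> inv\<^bsub>ext\<^esub> y"
  let ?V = "?c ` (?B \<times> ?B) \<union> (\<lambda>x. x [^]\<^bsub>ext\<^esub> p) ` ?B"
  let ?q = "card (carrier A) * card (carrier Q)"
  have split: "\<exists>b\<in>?B. \<exists>z\<in>carrier Z. b \<in> carrier ext \<and> x = b \<otimes>\<^bsub>ext\<^esub> cen z" if x: "x \<in> core" for x
  proof -
    obtain a z g where *: "x = (a, z, g)" "a \<in> carrier A" "z \<in> carrier Z" "g \<in> carrier Q"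
      by (rule coreE[OF x])
    have "x = (a, \<one>\<^bsub>Z\<^esub>, g) \<otimes>\<^bsub>ext\<^esub> cen z" unfolding *(1) by (rule ext_split[OF *(2-4)])
    then show ?thesis using * by (auto simp: ext_simps)
  qed
  have V: "verbal core_group p \<subseteq> ?V"
  proof
    fix v assume "v \<in> verbal core_group p"
    then consider (c) x y where "x \<in> core" "y \<in> core" "v = ?c (x, y)"
      | (p) x where "x \<in> core" "v = x [^]\<^bsub>ext\<^esub> p"
      using E.m_inv_consistent[OF core_subgroup]
      by (auto simp: verbal_def powers_def core_group_def nat_pow_carrier_update) 
    then show "v \<in> ?V"
    proof cases
      case c
      obtain b z where b: "b \<in> ?B" "z \<in> carrier Z" "b \<in> carrier ext" "x = b \<otimes>\<^bsub>ext\<^esub> cen z"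
        using split[OF c(1)] by blast
      obtain d w where d: "d \<in> ?B" "w \<in> carrier Z" "d \<in> carrier ext" "y = d \<otimes>\<^bsub>ext\<^esub> cen w"
        using split[OF c(2)] by blast
      have "v = ?c (b, d)"
        unfolding c(3) b(4) d(4) using b d by (simp add: E.commutator_central cen_central)
      then show ?thesis using b(1) d(1) by blast
    next
      case p
      obtain b z where b: "b \<in> ?B" "z \<in> carrier Z" "b \<in> carrier ext" "x = b \<otimes>\<^bsub>ext\<^esub> cen z"
        using split[OF p(1)] by blast
      have "v = b [^]\<^bsub>ext\<^esub> p \<otimes>\<^bsub>ext\<^esub> cen z [^]\<^bsub>ext\<^esub> p"
        unfolding p(2) b(4) using b by (intro E.pow_mult_distrib) (auto simp: cen_central)
      also have "cen z [^]\<^bsub>ext\<^esub> p = \<one>\<^bsub>ext\<^esub>" using b(2) Z by (simp flip: cen.hom_nat_pow)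
      finally show ?thesis using b by auto
    qed
  qed
  have B: "finite ?B" "card ?B \<le> ?q"
    using fin card_image_le[of "carrier A \<times> carrier Q" "\<lambda>(a, g). (a, \<one>\<^bsub>Z\<^esub>, g)"]
    by (auto simp: card_cartesian_product)
  show "finite (verbal core_group p)" using B by (intro finite_subset[OF V]) auto
  have "card (verbal core_group p) \<le> card ?V" using B by (intro card_mono V) auto
  also have "\<dots> \<le> card (?c ` (?B \<times> ?B)) + card ((\<lambda>x. x [^]\<^bsub>ext\<^esub> p) ` ?B)" by (rule card_Un_le)
  also have "\<dots> \<le> card (?B \<times> ?B) + card ?B" using B by (intro add_mono card_image_le) auto
  also have "\<dots> \<le> ?q * ?q + ?q" using B by (simp add: card_cartesian_product) (intro add_mono mult_mono; simp)
  also have "\<dots> \<le> ?q * ?q + ?q * ?q" by (intro add_left_mono) simp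
  finally show "card (verbal core_group p) \<le> 2 * ?q\<^sup>2" by (simp add: power2_eq_square)
qed

text \<open>The core contains a faithful copy of \<open>Z\<close>, which has more elements than
  there are products of \<open>n\<close> verbal elements.\<close>

lemma core_not_prods_verbal:
  assumes fin: "finite (carrier A)" "finite (carrier Q)"
    and Z: "\<And>z. z \<in> carrier Z \<Longrightarrow> z [^]\<^bsub>Z\<^esub> (p::nat) = \<one>\<^bsub>Z\<^esub>"
    and gen: "carrier Z \<subseteq> generate Z brackets"
    and large: "(2 * (card (carrier A) * card (carrier Q))\<^sup>2) ^ n < card (carrier Z)"
  shows "\<not> carrier core_group \<subseteq> prods core_group (verbal core_group p) n"
proof
  interpret C: group core_group by (rule group_core)
  note V = card_verbal_core[OF fin Z]
  note P = C.finite_card_prods[OF V(1), of n]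
  assume "carrier core_group \<subseteq> prods core_group (verbal core_group p) n"
  moreover have "cen ` carrier Z \<subseteq> carrier core_group"
    using cen_core[OF gen] by (auto simp: core_group_def)
  ultimately have "card (cen ` carrier Z) \<le> card (prods core_group (verbal core_group p) n)"
    using P by (intro card_mono) auto
  also have "\<dots> \<le> card (verbal core_group p) ^ n" using P by blast
  also have "\<dots> \<le> (2 * (card (carrier A) * card (carrier Q))\<^sup>2) ^ n"
    by (intro power_mono V(2) zero_le)
  also have "\<dots> < card (carrier Z)" by (rule large)
  also have "card (carrier Z) = card (cen ` carrier Z)"
    by (rule card_image[symmetric]) (auto simp: inj_on_def cen_def)
  finally show False by simp
qed

end

section \<open>The finite factors\<close>

text \<open>The functions from \<open>D\<close> to the integers modulo \<open>p\<close>, represented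
  by extensional functions with reduced residues as values.\<close>

definition modvec :: "'i set \<Rightarrow> nat \<Rightarrow> ('i \<Rightarrow> int) monoid" where
  "modvec D p = product_group D (\<lambda>_. integer_mod_group p)"

definition delta :: "'i set \<Rightarrow> 'i \<Rightarrow> int \<Rightarrow> 'i \<Rightarrow> int" where
  "delta D x k = (\<lambda>y\<in>D. if y = x then k else 0)"

lemma comm_group_vec: "comm_group (modvec D p)"
proof -
  interpret group "modvec D p" by (simp add: modvec_def)
  show ?thesis
    by (rule group_comm_groupI) (simp add: modvec_def add.commute)
qed

lemma modvec_simps:
  "p > 0 \<Longrightarrow> carrier (modvec D p) = (\<Pi>\<^sub>E i\<in>D. {0..<int p})"
  "a \<otimes>\<^bsub>modvec D p\<^esub> b = (\<lambda>i\<in>D. (a i + b i) mod int p)"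
  "\<one>\<^bsub>modvec D p\<^esub> = (\<lambda>i\<in>D. 0)"
  by (auto simp: modvec_def carrier_integer_mod_group)

lemma modvec_pow:
  assumes "a \<in> carrier (modvec D p)" "p > 0"
  shows "a [^]\<^bsub>modvec D p\<^esub> p = \<one>\<^bsub>modvec D p\<^esub>"
proof -
  have "a [^]\<^bsub>modvec D p\<^esub> n = (\<lambda>i\<in>D. (int n * a i) mod int p)" for n
    by (induction n) (auto simp: nat_pow_def modvec_simps mod_simps algebra_simps fun_eq_iff)
  then show ?thesis by (simp add: modvec_simps)
qed

lemma delta_carrier: "0 \<le> k \<Longrightarrow> k < int p \<Longrightarrow> delta D x k \<in> carrier (modvec D p)"
  by (subst modvec_simps) (auto simp: delta_def)

lemma card_vec: "finite D \<Longrightarrow> p > 0 \<Longrightarrow> card (carrier (modvec D p)) = p ^ card D"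
  by (simp add: modvec_simps card_PiE)

lemma finite_vec: "finite D \<Longrightarrow> p > 0 \<Longrightarrow> finite (carrier (modvec D p))"
  by (simp add: modvec_simps finite_PiE)

lemma modvec_generate:
  assumes p: "p > 0" and "finite D"
    and C: "C \<subseteq> carrier (modvec D p)" "\<And>x k. x \<in> D \<Longrightarrow> 0 \<le> k \<Longrightarrow> k < int p \<Longrightarrow> delta D x k \<in> C"
  shows "carrier (modvec D p) \<subseteq> generate (modvec D p) C"
proof
  interpret comm_group "modvec D p" by (rule comm_group_vec)
  fix z assume z: "z \<in> carrier (modvec D p)"
  then have zr: "0 \<le> z x" "z x < int p" if "x \<in> D" for x
    using that p by (auto simp: modvec_simps PiE_iff)
  have "(\<lambda>x\<in>D. if x \<in> F then z x else 0) \<in> generate (modvec D p) C" if "finite F" "F \<subseteq> D" for F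
    using that
  proof (induction F)
    case empty
    then show ?case using generate.one[of "modvec D p" C] by (simp only: modvec_simps empty_iff if_False)
  next
    case (insert x F)
    then have "(\<lambda>x\<in>D. if x \<in> F then z x else 0) \<otimes>\<^bsub>modvec D p\<^esub> delta D x (z x) \<in> generate (modvec D p) C"
      by (intro generate.eng[OF insert.IH generate.incl] C(2) zr) (use insert.prems in auto)
    also have "(\<lambda>x\<in>D. if x \<in> F then z x else 0) \<otimes>\<^bsub>modvec D p\<^esub> delta D x (z x)
      = (\<lambda>y\<in>D. if y \<in> insert x F then z y else 0)"
      using insert zr by (auto simp: modvec_simps delta_def fun_eq_iff)
    finally show ?case .
  qed
  from this[OF assms(2) subset_refl] have "(\<lambda>x\<in>D. if x \<in> D then z x else 0) \<in> generate (modvec D p) C" .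
  also have "(\<lambda>x\<in>D. if x \<in> D then z x else 0) = z"
    using z p by (auto simp: modvec_simps PiE_iff extensional_def fun_eq_iff)
  finally show "z \<in> generate (modvec D p) C" .
qed

section \<open>The regular representation and its invariant form\<close>

locale factor = Q: group Q for Q :: "('q, 'm) monoid_scheme" +
  fixes p r :: nat
  assumes finite_Q: "finite (carrier Q)" and prime_p: "Factorial_Ring.prime p"
begin

text \<open>Functions on \<open>DA\<close> are \<open>2 * r\<close> copies of the regular
  representation of \<open>Q\<close>. Pairing the first \<open>r\<close> copies with the last
  \<open>r\<close> gives \<open>r * r\<close> central coordinates, while the dimension of the vector
  part is linear in \<open>r\<close>.\<close>

definition "DA = carrier Q \<times> {..<2 * r}"
definition "DZ = {..<r} \<times> {..<r}"

definition shift :: "'q \<Rightarrow> ('q \<times> nat \<Rightarrow> int) \<Rightarrow> 'q \<times> nat \<Rightarrow> int" where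
  "shift g a = (\<lambda>y\<in>DA. a (inv\<^bsub>Q\<^esub> g \<otimes>\<^bsub>Q\<^esub> fst y, snd y))"

text \<open>Summation over \<open>Q\<close> gives invariance. The form is asymmetric: it reads its
  left argument on the first \<open>r\<close> copies only and its right argument on the last
  \<open>r\<close> only.\<close>

definition form :: "('q \<times> nat \<Rightarrow> int) \<Rightarrow> ('q \<times> nat \<Rightarrow> int) \<Rightarrow> nat \<times> nat \<Rightarrow> int" where
  "form a b = (\<lambda>y\<in>DZ. (\<Sum>x\<in>carrier Q. a (x, fst y) * b (x, r + snd y)) mod int p)"

lemma p_pos: "p > 0" using prime_p prime_gt_0_nat by blast

sublocale B: bilinear_extension Q "modvec DA p" "modvec DZ p" shift form
proof (intro bilinear_extension.intro bilinear_extension_axioms.intro Q.is_group comm_group_vec)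
  fix g a assume g: "g \<in> carrier Q" and a: "a \<in> carrier (modvec DA p)"
  show "shift g a \<in> carrier (modvec DA p)"
    using g a p_pos by (auto simp: modvec_simps shift_def DA_def PiE_iff)
next
  fix g a b assume "g \<in> carrier Q" "a \<in> carrier (modvec DA p)" "b \<in> carrier (modvec DA p)"
  then show "shift g (a \<otimes>\<^bsub>modvec DA p\<^esub> b) = shift g a \<otimes>\<^bsub>modvec DA p\<^esub> shift g b"
    by (auto simp: modvec_simps shift_def DA_def fun_eq_iff)
next
  fix a assume "a \<in> carrier (modvec DA p)"
  then show "shift \<one>\<^bsub>Q\<^esub> a = a"
    using p_pos by (auto simp: modvec_simps shift_def DA_def PiE_iff fun_eq_iff extensional_def)
next
  fix g h a assume "g \<in> carrier Q" "h \<in> carrier Q" "a \<in> carrier (modvec DA p)"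
  then show "shift (g \<otimes>\<^bsub>Q\<^esub> h) a = shift g (shift h a)"
    by (auto simp: shift_def DA_def fun_eq_iff Q.inv_mult_group Q.m_assoc)
next
  fix a b assume "a \<in> carrier (modvec DA p)" "b \<in> carrier (modvec DA p)"
  show "form a b \<in> carrier (modvec DZ p)"
    using p_pos by (auto simp: modvec_simps form_def)
next
  fix a b c assume abc: "a \<in> carrier (modvec DA p)" "b \<in> carrier (modvec DA p)" "c \<in> carrier (modvec DA p)"
  have "(\<Sum>x\<in>carrier Q. ((a (x, i) + b (x, i)) mod int p) * c (x, r + j)) mod int p
      = ((\<Sum>x\<in>carrier Q. a (x, i) * c (x, r + j)) mod int p + (\<Sum>x\<in>carrier Q. b (x, i) * c (x, r + j)) mod int p) mod int p"
    for i j
  proof -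
    have "[(\<Sum>x\<in>carrier Q. ((a (x, i) + b (x, i)) mod int p) * c (x, r + j))
       = (\<Sum>x\<in>carrier Q. (a (x, i) + b (x, i)) * c (x, r + j))] (mod int p)"
      by (intro cong_sum cong_mult cong_refl) (simp add: cong_def)
    then show ?thesis by (simp add: cong_def mod_simps distrib_right sum.distrib)
  qed
  then show "form (a \<otimes>\<^bsub>modvec DA p\<^esub> b) c = form a c \<otimes>\<^bsub>modvec DZ p\<^esub> form b c"
    by (auto simp: form_def modvec_simps fun_eq_iff DA_def DZ_def)
  have "(\<Sum>x\<in>carrier Q. a (x, i) * ((b (x, r + j) + c (x, r + j)) mod int p)) mod int p
      = ((\<Sum>x\<in>carrier Q. a (x, i) * b (x, r + j)) mod int p + (\<Sum>x\<in>carrier Q. a (x, i) * c (x, r + j)) mod int p) mod int p"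
    for i j
  proof -
    have "[(\<Sum>x\<in>carrier Q. a (x, i) * ((b (x, r + j) + c (x, r + j)) mod int p))
       = (\<Sum>x\<in>carrier Q. a (x, i) * (b (x, r + j) + c (x, r + j)))] (mod int p)"
      by (intro cong_sum cong_mult cong_refl) (simp add: cong_def)
    then show ?thesis by (simp add: cong_def mod_simps distrib_left sum.distrib)
  qed
  then show "form a (b \<otimes>\<^bsub>modvec DA p\<^esub> c) = form a b \<otimes>\<^bsub>modvec DZ p\<^esub> form a c"
    by (auto simp: form_def modvec_simps fun_eq_iff DA_def DZ_def)
next
  fix g a b assume g: "g \<in> carrier Q" and "a \<in> carrier (modvec DA p)" "b \<in> carrier (modvec DA p)"
  \<comment> \<open>Translation by \<open>g\<close> permutes the index set of the sum.\<close>
  have "(\<Sum>x\<in>carrier Q. a (inv\<^bsub>Q\<^esub> g \<otimes>\<^bsub>Q\<^esub> x, i) * b (inv\<^bsub>Q\<^esub> g \<otimes>\<^bsub>Q\<^esub> x, j)) = (\<Sum>x\<in>carrier Q. a (x, i) * b (x, j))"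
    for i j
    by (rule sum.reindex_bij_witness[where i = "\<lambda>x. g \<otimes>\<^bsub>Q\<^esub> x" and j = "\<lambda>x. inv\<^bsub>Q\<^esub> g \<otimes>\<^bsub>Q\<^esub> x"])
       (use g in \<open>auto simp flip: Q.m_assoc\<close>)
  then show "form (shift g a) (shift g b) = form a b"
    by (auto simp: form_def shift_def DA_def DZ_def fun_eq_iff)
qed

lemma shift_delta: "g \<in> carrier Q \<Longrightarrow> x \<in> carrier Q \<Longrightarrow>
    shift g (delta DA (x, i) k) = delta DA (g \<otimes>\<^bsub>Q\<^esub> x, i) k"
  by (auto simp: shift_def delta_def DA_def fun_eq_iff Q.inv_solve_left')

lemma form_delta:
  assumes "i < r" "j < r" "x \<in> carrier Q" "y \<in> carrier Q"
  shows "form (delta DA (x, i) k) (delta DA (y, r + j) 1) =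
    (if x = y then delta DZ (i, j) (k mod int p) else \<one>\<^bsub>modvec DZ p\<^esub>)"
proof -
  have "(\<Sum>u\<in>carrier Q. delta DA (x, i) k (u, i') * delta DA (y, r + j) 1 (u, r + j'))
     = (if x = y \<and> i' = i \<and> j' = j then k else 0)" if "i' < r" "j' < r" for i' j'
  proof -
    have "(\<Sum>u\<in>carrier Q. delta DA (x, i) k (u, i') * delta DA (y, r + j) 1 (u, r + j'))
       = (\<Sum>u\<in>carrier Q. if u = x then (if x = y \<and> i' = i \<and> j' = j then k else 0) else 0)"
      using that assms by (intro sum.cong) (auto simp: delta_def DA_def)
    then show ?thesis using finite_Q assms by simp
  qed
  then have *: "form (delta DA (x, i) k) (delta DA (y, r + j) 1) =
      (\<lambda>u\<in>DZ. if x = y \<and> fst u = i \<and> snd u = j then k mod int p else 0)"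
    unfolding form_def by (intro restrict_ext) (auto simp: DZ_def)
  show ?thesis
    unfolding * by (auto simp: modvec_simps delta_def fun_eq_iff)
qed

lemma form_delta_zero:
  assumes "i < r"
  shows "form (delta DA (y, r + j) m) (delta DA (x, i) k) = \<one>\<^bsub>modvec DZ p\<^esub>"
proof -
  have "(\<Sum>u\<in>carrier Q. delta DA (y, r + j) m (u, i') * delta DA (x, i) k (u, r + j')) = 0"
    if "i' < r" "j' < r" for i' j'
    using that assms by (intro sum.neutral) (auto simp: delta_def DA_def)
  then show ?thesis
    by (auto simp: form_def modvec_simps DZ_def fun_eq_iff)
qed

text \<open>\<open>?c\<close> and \<open>?d\<close> are displacements of coordinate vectors at the
  identity. As the identity, \<open>g\<close> and \<open>h\<close> are distinct, only the pairing at
  the identity survives, and the reversed pairing vanishes; so all multiples of coordinate vectors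
  are brackets.\<close>

lemma generate_forms:
  assumes g: "g \<in> carrier Q" "h \<in> carrier Q" "g \<noteq> \<one>\<^bsub>Q\<^esub>" "h \<noteq> \<one>\<^bsub>Q\<^esub>" "g \<noteq> h"
  shows "carrier (modvec DZ p) \<subseteq> generate (modvec DZ p) B.brackets"
proof (rule modvec_generate[OF p_pos _ B.brackets_carrier])
  show "finite DZ" by (simp add: DZ_def)
  fix y k assume "y \<in> DZ" and k: "0 \<le> k" "k < int p"
  then obtain i j where y: "y = (i, j)" "i < r" "j < r" by (auto simp: DZ_def)
  let ?a = "\<lambda>x. delta DA (x, i) k" and ?b = "\<lambda>x. delta DA (x, r + j) 1"
  let ?c = "?a \<one>\<^bsub>Q\<^esub> \<otimes>\<^bsub>modvec DA p\<^esub> inv\<^bsub>modvec DA p\<^esub> ?a g"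
  let ?d = "?b \<one>\<^bsub>Q\<^esub> \<otimes>\<^bsub>modvec DA p\<^esub> inv\<^bsub>modvec DA p\<^esub> ?b h"
  have [simp]: "?a x \<in> carrier (modvec DA p)" "?b x \<in> carrier (modvec DA p)" for x
    using k prime_gt_1_nat[OF prime_p] by (auto intro: delta_carrier)
  have cd: "?c \<in> B.displacements" "?d \<in> B.displacements"
    using B.displacementsI[OF g(1), of "?a \<one>\<^bsub>Q\<^esub>"] B.displacementsI[OF g(2), of "?b \<one>\<^bsub>Q\<^esub>"] g(1,2)
    by (simp_all add: shift_delta)
  have [simp]: "delta DZ (i, j) k \<in> carrier (modvec DZ p)" using k by (rule delta_carrier)
  have "form ?c ?d = delta DZ (i, j) k" 
    using y g k by (simp add: B.form_mult_left B.form_mult_right B.hom_simps form_delta)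
  moreover have "form ?d ?c = \<one>\<^bsub>modvec DZ p\<^esub>"
    using y g k by (simp add: B.form_mult_left B.form_mult_right B.hom_simps form_delta_zero)
  ultimately have "delta DZ y k = form ?c ?d \<otimes>\<^bsub>modvec DZ p\<^esub> inv\<^bsub>modvec DZ p\<^esub> form ?d ?c"
    using y by simp
  then show "delta DZ y k \<in> B.brackets"
    using B.bracketsI[OF cd] by (simp only:)
qed

end

text \<open>\<open>N\<close> is the order of \<open>Q\<close>, and the vector part has dimension
  \<open>N * (2 * r)\<close>. Using \<open>N \<le> p ^ N\<close>, the base is at most
  \<open>p ^ (7 * r * N)\<close>; its \<open>n\<close>-th power stays below
  \<open>p ^ (r * r)\<close> because \<open>r\<close> exceeds \<open>7 * n * N\<close>.\<close>

lemma counting_bound: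
  fixes p N n r :: nat
  assumes "p \<ge> 2" "N > 0" "r = 7 * n * N + 1"
  shows "(2 * (p ^ (N * (2 * r)) * N)\<^sup>2) ^ n < p ^ (r * r)"
proof -
  have "N \<le> 2 ^ N" by simp
  also have "\<dots> \<le> p ^ N" using assms by (intro power_mono) auto
  finally have "p ^ (N * (2 * r)) * N \<le> p ^ (N * (2 * r)) * p ^ N" by simp
  then have "(p ^ (N * (2 * r)) * N)\<^sup>2 \<le> (p ^ (N * (2 * r) + N))\<^sup>2"
    by (intro power_mono) (simp_all add: power_add)
  then have "2 * (p ^ (N * (2 * r)) * N)\<^sup>2 \<le> p ^ 1 * (p ^ (N * (2 * r) + N))\<^sup>2"
    using assms by (intro mult_mono) auto
  also have "\<dots> = p ^ (1 + 2 * (N * (2 * r) + N))" 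
    by (simp only: power_add[of p 1] power_even_eq)
  also have "\<dots> \<le> p ^ (7 * r * N)"
  proof (intro power_increasing)
    have "1 \<le> r * N" "N \<le> r * N" using assms by auto
    moreover have "1 + 2 * (N * (2 * r) + N) = 1 + 4 * (r * N) + 2 * N" "7 * r * N = 7 * (r * N)" by simp_all
    ultimately show "1 + 2 * (N * (2 * r) + N) \<le> 7 * r * N" by linarith
  qed (use assms in auto)
  finally have "(2 * (p ^ (N * (2 * r)) * N)\<^sup>2) ^ n \<le> (p ^ (7 * r * N)) ^ n"
    by (rule power_mono) simp
  also have "\<dots> = p ^ (r * (7 * n * N))" by (simp flip: power_mult add: mult_ac)
  also have "\<dots> < p ^ (r * r)" using assms by (intro power_strict_increasing mult_strict_left_mono) auto
  finally show ?thesis .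
qed


text \<open>The width 5, four unipotents and one kernel element, is independent of \<open>n\<close>,
  whereas the verbal width for \<open>p\<close> exceeds \<open>n\<close>. In the product this
  contrast separates exponents prime to \<open>S\<close> from the primes in
  \<open>S\<close>.\<close>

definition layer :: "nat \<Rightarrow> nat \<Rightarrow> ('a, 'b) monoid_scheme \<Rightarrow> bool" where
  "layer p n G \<longleftrightarrow> group G \<and> finite (carrier G) \<and> derived G (carrier G) = carrier G \<and>
    (\<forall>m. 0 < m \<and> m \<le> n \<longrightarrow> power_subgroup G m = carrier G) \<and>
    (\<forall>m. 0 < m \<and> m \<le> n \<and> coprime m p \<longrightarrow> carrier G \<subseteq> prods G (powers G m) 5) \<and>
    \<not> carrier G \<subseteq> prods G (verbal G p) n"

lemma layer_exists:
  assumes p: "Factorial_Ring.prime (p::nat)"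
  shows "\<exists>G :: (((int \<times> int \<times> int \<times> int) \<times> nat \<Rightarrow> int) \<times> (nat \<times> nat \<Rightarrow> int) \<times> (int \<times> int \<times> int \<times> int)) monoid.
    layer p n G"
proof -
  \<comment> \<open>This gives \<open>l > 3\<close>, needed for perfectness, and makes
    \<open>l\<close> prime to every exponent from 1 to \<open>n\<close>.\<close>
  obtain l :: nat where l: "Factorial_Ring.prime l" "l > n + 3"
    using bigger_prime by blast
  define Q where "Q = sl2 (int l)"
  \<comment> \<open>The value demanded by \<open>counting_bound\<close>.\<close>
  define r where "r = 7 * n * card (carrier Q) + 1"
  have l3: "l > 3" using l by simp
  interpret Q: group Q unfolding Q_def by (rule group_sl2)
  have finQ: "finite (carrier Q)" unfolding Q_def using l(2) by (intro finite_sl2) simp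
  interpret F: factor Q p r
    by unfold_locales (use finQ p in auto)
  have p0: "p > 0" by (rule F.p_pos)
  let ?G = "F.B.core_group"
  have cop: "coprime m l" if "0 < m" "m \<le> n" for m
    using that l by (metis coprime_commute nat_dvd_not_less le_add1 order.strict_trans2 order.strict_trans1 prime_imp_coprime)
  have Q4: "carrier Q \<subseteq> prods Q (torsion Q l) 4"
    using sl2_prods_elementary[OF l(1)] prods_mono_set[OF elementary_torsion, where G = "sl2 (int l)" and k = 4]
    unfolding Q_def by blast
  have fin: "finite (carrier (modvec F.DA p))" "finite (carrier (modvec F.DZ p))"
    using finQ p0 by (auto intro!: finite_vec simp: F.DA_def F.DZ_def)
  have cards: "card (carrier (modvec F.DA p)) = p ^ (card (carrier Q) * (2 * r))"
      "card (carrier (modvec F.DZ p)) = p ^ (r * r)"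
    using finQ p0 by (simp_all add: card_vec F.DA_def F.DZ_def card_cartesian_product)
  have large: "(2 * (card (carrier (modvec F.DA p)) * card (carrier Q))\<^sup>2) ^ n < card (carrier (modvec F.DZ p))"
    unfolding cards using finQ prime_ge_2_nat[OF p]
    by (intro counting_bound) (auto simp: r_def card_gt_0_iff)
  have inl: "1 < int l" "2 < int l" "0 < int l" using l3 by auto
  have gen: "carrier (modvec F.DZ p) \<subseteq> generate (modvec F.DZ p) F.B.brackets"
  proof (rule F.generate_forms)
    \<comment> \<open>Unipotents with entries 1 and 2 serve as the two distinct nontrivial elements,
      since \<open>l > 3\<close>.\<close>
    show "mat2 (int l) 1 1 0 1 \<in> carrier Q" "mat2 (int l) 1 2 0 1 \<in> carrier Q"
      unfolding Q_def by (rule carrier_sl2I; simp)+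
    show "mat2 (int l) 1 1 0 1 \<noteq> \<one>\<^bsub>Q\<^esub>" "mat2 (int l) 1 2 0 1 \<noteq> \<one>\<^bsub>Q\<^esub>"
      "mat2 (int l) 1 1 0 1 \<noteq> mat2 (int l) 1 2 0 1"
      using inl by (auto simp: Q_def one_sl2 mat2_def)
  qed
  have "finite (carrier (F.B.ext))" using fin finQ by (simp add: F.B.ext_simps)
  then have 1: "finite (carrier ?G)"
    using finite_subset[OF F.B.core_carrier] by (simp add: F.B.core_group_def)
  have 2: "derived ?G (carrier ?G) = carrier ?G"
    by (rule F.B.derived_core) (simp add: Q_def sl2_perfect l l3)
  have 3: "power_subgroup ?G m = carrier ?G" if "0 < m" "m \<le> n" for m
    by (rule F.B.power_subgroup_core[OF Q4 cop[OF that]])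
  have "carrier ?G \<subseteq> prods ?G (powers ?G m) (Suc 4)" if "0 < m" "m \<le> n" "coprime m p" for m
    by (rule F.B.core_prods_powers[OF Q4 modvec_pow[OF _ p0] modvec_pow[OF _ p0] cop[OF that(1,2)] that(3)])
  then have 4: "carrier ?G \<subseteq> prods ?G (powers ?G m) 5" if "0 < m" "m \<le> n" "coprime m p" for m
    using that by (simp only: eval_nat_numeral)
  have 5: "\<not> carrier ?G \<subseteq> prods ?G (verbal ?G p) n"
    by (rule F.B.core_not_prods_verbal[OF fin(1) finQ modvec_pow[OF _ p0] gen large])
  have "layer p n ?G"
    unfolding layer_def using F.B.group_core 1 2 3 4 5 by (intro conjI allI impI; (elim conjE)?)
  then show ?thesis by (rule exI)
qed

section \<open>Transport of structure\<close>

text \<open>It relabels the finite factors by natural numbers, so that the product group consists of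
  sequences of naturals.\<close>

definition image_monoid :: "('a \<Rightarrow> 'c) \<Rightarrow> ('a, 'b) monoid_scheme \<Rightarrow> 'c monoid" where
  "image_monoid f G = \<lparr>carrier = f ` carrier G,
     monoid.mult = (\<lambda>x y. f (inv_into (carrier G) f x \<otimes>\<^bsub>G\<^esub> inv_into (carrier G) f y)),
     one = f \<one>\<^bsub>G\<^esub>\<rparr>"

lemma image_monoid_hom:
  assumes "group G" "inj_on f (carrier G)"
  shows "group_hom G (image_monoid f G) f"
proof -
  interpret group G by fact
  have "group (image_monoid f G)"
  proof (rule groupI)
    fix x assume "x \<in> carrier (image_monoid f G)"
    then obtain y where y: "x = f y" "y \<in> carrier G" by (auto simp: image_monoid_def)
    then show "\<exists>y\<in>carrier (image_monoid f G). y \<otimes>\<^bsub>image_monoid f G\<^esub> x = \<one>\<^bsub>image_monoid f G\<^esub>"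
      using assms(2) by (auto simp: image_monoid_def intro!: bexI[of _ "inv\<^bsub>G\<^esub> y"])
  qed (use assms(2) in \<open>auto simp: image_monoid_def m_assoc\<close>)
  then show ?thesis
    using assms by (intro group_hom.intro group_hom_axioms.intro homI) (auto simp: image_monoid_def)
qed

context group_hom
begin

lemma powers_image:
  assumes "h ` carrier G = carrier H" shows "h ` powers G m = powers H m"
  unfolding powers_def using hom_nat_pow by (auto simp flip: assms simp: image_iff) force+

lemma derived_set_image:
  assumes "h ` carrier G = carrier H"
  shows "h ` derived_set G (carrier G) = derived_set H (carrier H)"
  unfolding assms[symmetric] by (simp add: image_UN)

lemma verbal_image:
  assumes "h ` carrier G = carrier H" shows "h ` verbal G p = verbal H p"
  unfolding verbal_def image_Un powers_image[OF assms] derived_set_image[OF assms] ..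

lemma layer_transfer:
  assumes im: "h ` carrier G = carrier H" and inj: "inj_on h (carrier G)" and "layer p n G"
  shows "layer p n H"
proof -
  have fin: "finite (carrier G)" and perfect: "derived G (carrier G) = carrier G"
    and power: "\<And>m. 0 < m \<Longrightarrow> m \<le> n \<Longrightarrow> power_subgroup G m = carrier G"
    and width: "\<And>m. 0 < m \<Longrightarrow> m \<le> n \<Longrightarrow> coprime m p \<Longrightarrow> carrier G \<subseteq> prods G (powers G m) 5"
    and nwidth: "\<not> carrier G \<subseteq> prods G (verbal G p) n"
    using assms(3) by (simp_all add: layer_def)
  have 1: "finite (carrier H)" unfolding im[symmetric] using fin by (rule finite_imageI)
  have 2: "derived H (carrier H) = carrier H"
    using derived_img[of "carrier G"] perfect im by simp
  have 3: "power_subgroup H m = carrier H" if "0 < m" "m \<le> n" for m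
    using generate_img[OF G.powers_carrier, of m] power[OF that] im
    by (simp add: power_subgroup_eq powers_image)
  have 4: "carrier H \<subseteq> prods H (powers H m) 5" if "0 < m" "m \<le> n" "coprime m p" for m
    using image_mono[OF width[OF that], of h]
    unfolding prods_image[OF group_hom_axioms G.powers_carrier] im powers_image[OF im] .
  have 5: "\<not> carrier H \<subseteq> prods H (verbal H p) n"
  proof
    assume "carrier H \<subseteq> prods H (verbal H p) n"
    then have "h ` carrier G \<subseteq> h ` prods G (verbal G p) n"
      unfolding prods_image[OF group_hom_axioms G.verbal_carrier] im verbal_image[OF im] .
    \<comment> \<open>Injectivity pulls the inclusion back; the other clauses pass to any surjective
      homomorphic image.\<close>
    then have "carrier G \<subseteq> prods G (verbal G p) n"
      by (simp add: inj_on_image_subset_iff[OF inj subset_refl] G.prods_carrier[OF G.verbal_carrier])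
    then show False using nwidth by blast
  qed
  show ?thesis
    unfolding layer_def using H.is_group 1 2 3 4 5 by (intro conjI allI impI; (elim conjE)?)
qed

end

lemma layer_image:
  fixes G :: "('a, 'b) monoid_scheme"
  assumes "layer p n G"
  shows "\<exists>H :: nat monoid. layer p n H"
proof -
  have G: "group G" "countable (carrier G)"
    using assms by (simp_all add: layer_def countable_finite)
  have inj: "inj_on (to_nat_on (carrier G)) (carrier G)"
    by (rule inj_on_to_nat_on[OF G(2)])
  have "layer p n (image_monoid (to_nat_on (carrier G)) G)"
    by (rule group_hom.layer_transfer[OF image_monoid_hom[OF G(1) inj] _ inj assms])
       (simp add: image_monoid_def)
  then show ?thesis by (rule exI)
qed

lemma nat_layer_exists:
  assumes "Factorial_Ring.prime (p::nat)"
  shows "\<exists>G :: nat monoid. layer p n G"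
  using layer_exists[OF assms, of n] by (elim exE layer_image)

section \<open>Subgroups of finite index\<close>

lemma (in normal) hom_Mod: "group_hom G (G Mod H) (\<lambda>a. H #> a)"
  by (intro group_hom.intro group_hom_axioms.intro is_group factorgroup_is_group r_coset_hom_Mod)

lemma (in normal) rcos_eq_iff: "a \<in> carrier G \<Longrightarrow> H #> a = H \<longleftrightarrow> a \<in> H"
  using coset_join1 coset_join2 subset subgroup_axioms by blast

lemma (in normal) group_index_order: "group_index G H = order (G Mod H)"
  by (simp add: group_index_def order_def FactGroup_def)

text \<open>This is Lagrange in the quotient. For infinite index \<open>group_index\<close> is 0,
  and 0-th powers are trivial.\<close>

lemma (in normal) powers_subset_index: "powers G (group_index G H) \<subseteq> H"
proof
  interpret Q: group_hom G "G Mod H" "\<lambda>a. H #> a" by (rule hom_Mod)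
  fix x assume "x \<in> powers G (group_index G H)"
  then obtain g where g: "g \<in> carrier G" "x = g [^] group_index G H" by (auto simp: powers_def)
  have "H #> x = (H #> g) [^]\<^bsub>G Mod H\<^esub> order (G Mod H)"
    using g by (simp add: Q.hom_nat_pow group_index_order)
  also have "\<dots> = H" using Q.H.pow_order_eq_1[OF Q.hom_closed[OF g(1)]] by simp
  finally show "x \<in> H" using g by (simp add: rcos_eq_iff)
qed

lemma (in group) group_prime_order_comm:
  assumes "Factorial_Ring.prime (order G)"
  shows "comm_group G"
proof -
  have fin: "finite (carrier G)"
    using assms by (metis card.infinite not_prime_0 order_def)
  have "card (carrier G) \<noteq> 1" using assms by (auto simp: order_def)
  then obtain a where a: "a \<in> carrier G" "a \<noteq> \<one>"
    by (metis card_1_singleton_iff One_nat_def one_closed singletonI subset_singleton_iff subsetI equals0D)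
  have "ord a dvd order G" by (rule ord_dvd_group_order[OF a(1)])
  then have "ord a = order G" using assms a ord_eq_1 prime_nat_iff by metis
  then have "card (generate G {a}) = card (carrier G)"
    by (simp add: generate_pow_card[OF a(1)] order_def)
  then have gen: "generate G {a} = carrier G"
    using a(1) fin by (intro card_subset_eq generate_incl) auto
  show ?thesis
  proof (rule group_comm_groupI)
    fix x y assume "x \<in> carrier G" "y \<in> carrier G"
    then have "x \<in> generate G {a}" "y \<in> generate G {a}" unfolding gen .
    then obtain i j :: int where "x = a [^] i" "y = a [^] j"
      unfolding generate_pow[OF a(1)] by blast
    then show "x \<otimes> y = y \<otimes> x" using a(1) by (simp add: add.commute flip: int_pow_mult)
  qed
qed

lemma (in normal) derived_subset_prime_index:
  assumes "Factorial_Ring.prime (group_index G H)"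
  shows "derived G (carrier G) \<subseteq> H"
proof -
  interpret Q: group "G Mod H" by (rule factorgroup_is_group)
  show ?thesis
    using derived_minimal[OF normal_axioms] Q.group_prime_order_comm assms
    by (simp add: group_index_order)
qed

text \<open>Among the cosets of the powers of \<open>g\<close> with exponents 0 to \<open>k\<close>
  two coincide, so some power with exponent between 1 and \<open>k\<close> lies in \<open>H\<close>;
  that exponent divides \<open>fact k\<close>.\<close>

lemma (in group) power_fact_index:
  assumes H: "subgroup H G" and k: "group_index G H = k" "k \<ge> 1" and g: "g \<in> carrier G"
  shows "g [^] (fact k :: nat) \<in> H"
proof -
  have fin: "finite (rcosets H)"
    using k by (metis card.infinite group_index_def not_one_le_zero)
  have "\<not> inj_on (\<lambda>i::nat. H #> (g [^] i)) {..k}"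
  proof
    assume "inj_on (\<lambda>i::nat. H #> (g [^] i)) {..k}"
    then have "card {..k} \<le> card (rcosets H)"
      using g subgroup.subset[OF H] by (intro card_inj_on_le fin) (auto intro: rcosetsI)
    then show False using k by (simp add: group_index_def)
  qed
  then obtain i j :: nat where ij: "i < j" "j \<le> k" "H #> (g [^] i) = H #> (g [^] j)"
    by (auto simp: inj_on_def) (metis linorder_neqE_nat)
  have "g [^] j \<in> H #> (g [^] i)" using g H ij(3) rcos_self[of "g [^] j" H] by simp
  then obtain h where h: "h \<in> H" "g [^] j = h \<otimes> g [^] i" by (auto simp: r_coset_def)
  have "g [^] (j - i) \<otimes> g [^] i = h \<otimes> g [^] i"
    using ij g h(2) by (simp add: nat_pow_mult)
  then have "g [^] (j - i) \<in> H"
    using g h(1) subgroup.mem_carrier[OF H h(1)] by simp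
  moreover have "(j - i) dvd fact k" using ij by (intro dvd_fact) auto
  then obtain c where "(fact k :: nat) = (j - i) * c" by (elim dvdE)
  ultimately show ?thesis
    using subgroup_int_pow_closed[OF H, of "g [^] (j - i)" "int c"] g
    by (simp add: int_pow_int nat_pow_pow)
qed

text \<open>Modulo \<open>H\<close> the group is elementary abelian. For \<open>M\<close> maximal
  over \<open>H\<close> without \<open>x\<close>, the image of \<open>x\<close> lies in every
  nontrivial subgroup of the quotient, so the quotient is cyclic of order \<open>p\<close>.\<close>

lemma (in group) maximal_avoiding:
  assumes H: "subgroup H G" "derived G (carrier G) \<subseteq> H" "powers G p \<subseteq> H"
    and p: "Factorial_Ring.prime (p::nat)" and x: "x \<in> carrier G" "x \<notin> H"
  obtains M where "M \<lhd> G" "H \<subseteq> M" "x \<notin> M" "group_index G M = p"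
proof -
  define \<A> where "\<A> = {M. subgroup M G \<and> H \<subseteq> M \<and> x \<notin> M}"
  have "\<exists>M\<in>\<A>. \<forall>K\<in>\<A>. M \<subseteq> K \<longrightarrow> K = M"
  proof (rule subset_Zorn_nonempty)
    show "\<A> \<noteq> {}" using H x by (auto simp: \<A>_def)
    fix \<C> assume C: "\<C> \<noteq> {}" "subset.chain \<A> \<C>"
    then have sub: "\<And>M. M \<in> \<C> \<Longrightarrow> subgroup M G \<and> H \<subseteq> M \<and> x \<notin> M"
      and chain: "\<And>M N. M \<in> \<C> \<Longrightarrow> N \<in> \<C> \<Longrightarrow> M \<subseteq> N \<or> N \<subseteq> M"
      by (auto simp: \<A>_def subset.chain_def subset_chain_def)
    have "subgroup (\<Union>\<C>) G"
    proof (rule subgroupI)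
      show "\<Union>\<C> \<subseteq> carrier G" using sub by (auto dest: subgroup.mem_carrier)
      obtain K where "K \<in> \<C>" using C(1) by blast
      moreover from this have "\<one> \<in> K" using sub by (simp add: subgroup.one_closed)
      ultimately show "\<Union>\<C> \<noteq> {}" by blast
      show "inv a \<in> \<Union>\<C>" if "a \<in> \<Union>\<C>" for a
        using that sub by (auto dest: subgroup.m_inv_closed)
      show "a \<otimes> b \<in> \<Union>\<C>" if "a \<in> \<Union>\<C>" "b \<in> \<Union>\<C>" for a b
      proof -
        obtain M N where MN: "M \<in> \<C>" "N \<in> \<C>" "a \<in> M" "b \<in> N" using \<open>a \<in> \<Union>\<C>\<close> \<open>b \<in> \<Union>\<C>\<close> by blast
        then consider "M \<subseteq> N" | "N \<subseteq> M" using chain by blast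
        then show ?thesis
        proof cases
          case 1
          then have "a \<otimes> b \<in> N" using MN sub[OF MN(2)] by (auto intro: subgroup.m_closed)
          then show ?thesis using MN(2) by blast
        next
          case 2
          then have "a \<otimes> b \<in> M" using MN sub[OF MN(1)] by (auto intro: subgroup.m_closed)
          then show ?thesis using MN(1) by blast
        qed
      qed
    qed
    then show "\<Union>\<C> \<in> \<A>" using C(1) sub by (auto simp: \<A>_def)
  qed
  then obtain M where M: "subgroup M G" "H \<subseteq> M" "x \<notin> M"
    and max: "\<And>K. subgroup K G \<Longrightarrow> M \<subseteq> K \<Longrightarrow> x \<notin> K \<Longrightarrow> K = M"
    using H(1) by (auto simp: \<A>_def)
  have normal: "M \<lhd> G"
  proof (rule normal_invI[OF M(1)])
    fix g h assume g: "g \<in> carrier G" and h: "h \<in> M"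
    have hc: "h \<in> carrier G" using subgroup.mem_carrier[OF M(1) h] .
    have "g \<otimes> h \<otimes> inv g \<otimes> inv h \<in> derived G (carrier G)"
      unfolding derived_def using g hc by (intro generate.incl) blast
    then have "(g \<otimes> h \<otimes> inv g \<otimes> inv h) \<otimes> h \<in> M" using H(2) M(2) by (intro subgroup.m_closed[OF M(1) _ h]) auto
    then show "g \<otimes> h \<otimes> inv g \<in> M" using g hc by (simp add: m_assoc)
  qed
  interpret M: normal M G by (rule normal)
  let ?Q = "G Mod M" and ?f = "\<lambda>a. M #> a"
  interpret f: group_hom G ?Q ?f by (rule M.hom_Mod)
  have fone: "?f a = \<one>\<^bsub>?Q\<^esub> \<longleftrightarrow> a \<in> M" if "a \<in> carrier G" for a
    using M.rcos_eq_iff[OF that] by simp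
  have fp: "?f y [^]\<^bsub>?Q\<^esub> p = \<one>\<^bsub>?Q\<^esub>" if "y \<in> carrier G" for y
  proof -
    have "y [^] p \<in> M" using that H(3) M(2) by (auto simp: powers_def)
    then show ?thesis using that fone[of "y [^] p"] f.hom_nat_pow[of y p] by simp
  qed
  have gen: "?f y \<in> generate ?Q {?f x}" if y: "y \<in> carrier G" for y
  proof (cases "y \<in> M")
    case True
    then show ?thesis using fone[OF y] generate.one[of ?Q "{?f x}"] by simp
  next
    case False
    have fy: "?f y \<in> carrier ?Q" and fx: "?f x \<in> carrier ?Q" using y x by (auto intro: f.hom_closed)
    \<comment> \<open>For \<open>y\<close> outside \<open>M\<close> this subgroup is strictly larger
      than \<open>M\<close>, so maximality puts \<open>x\<close> into it.\<close>
    let ?K = "{a \<in> carrier G. ?f a \<in> generate ?Q {?f y}}"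
    have sK: "subgroup ?K G"
      using fy by (intro f.subgroup_vimage f.H.generate_is_subgroup) auto
    have "M \<subseteq> ?K"
    proof
      fix a assume "a \<in> M"
      moreover from this have "a \<in> carrier G" by (rule M.mem_carrier)
      ultimately show "a \<in> ?K" using fone[of a] generate.one[of ?Q "{?f y}"] by simp
    qed
    moreover have "y \<in> ?K" using y by (auto intro: generate.incl)
    ultimately have "x \<in> ?K" using max[OF sK] False by blast
    then obtain k :: int where k: "?f x = ?f y [^]\<^bsub>?Q\<^esub> k"
      using f.H.generate_pow[OF fy] by auto
    have fpi: "?f y [^]\<^bsub>?Q\<^esub> (int p * t) = \<one>\<^bsub>?Q\<^esub>" for t
    proof -
      have "?f y [^]\<^bsub>?Q\<^esub> (int p * t) = (?f y [^]\<^bsub>?Q\<^esub> int p) [^]\<^bsub>?Q\<^esub> t"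
        by (rule f.H.int_pow_pow[OF fy, symmetric])
      also have "\<dots> = \<one>\<^bsub>?Q\<^esub>" by (simp only: int_pow_int fp[OF y] f.H.int_pow_one)
      finally show ?thesis .
    qed
    have "\<not> int p dvd k"
    proof
      assume "int p dvd k"
      then have "?f x = \<one>\<^bsub>?Q\<^esub>" using k fpi by (auto elim!: dvdE)
      then show False using fone[OF x(1)] M(3) by simp
    qed
    \<comment> \<open>As \<open>k\<close> is a unit modulo \<open>p\<close>, the relation expressing
      \<open>x\<close> as a power of \<open>y\<close> can be solved for \<open>y\<close>.\<close>
    then obtain j where "[k * j = 1] (mod int p)" using prime_cong_inverse[OF p] by blast
    then obtain t where t: "1 = k * j + int p * t" by (auto simp: cong_iff_lin)
    have "?f y = ?f y [^]\<^bsub>?Q\<^esub> (k * j + int p * t)" using fy by (simp flip: t)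
    also have "\<dots> = ?f x [^]\<^bsub>?Q\<^esub> j"
      unfolding k f.H.int_pow_mult[OF fy] fpi f.H.int_pow_pow[OF fy] using fy by (intro f.H.r_one) simp
    finally show ?thesis using f.H.generate_pow[OF fx] by blast
  qed
  have fx: "?f x \<in> carrier ?Q" using x by (auto intro: f.hom_closed)
  have "generate ?Q {?f x} = carrier ?Q"
    using gen f.H.generate_incl[of "{?f x}"] fx by (auto simp: carrier_FactGroup)
  then have "group_index G M = f.H.ord (?f x)"
    unfolding M.group_index_order order_def f.H.generate_pow_card[OF fx] by simp
  also have "\<dots> = p"
  proof -
    have "f.H.ord (?f x) dvd p" using f.H.pow_eq_id[OF fx] fp[OF x(1)] by blast
    moreover have "f.H.ord (?f x) \<noteq> 1" using f.H.ord_eq_1[OF fx] fone[OF x(1)] M(3) by simp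
    ultimately show ?thesis using p prime_nat_iff by blast
  qed
  finally show thesis by (rule that[OF normal M(2,3)])
qed

section \<open>Countable products of finite groups\<close>

locale finite_product =
  fixes L :: "nat \<Rightarrow> nat monoid"
  assumes group_L: "\<And>n. group (L n)" and finite_L: "\<And>n. finite (carrier (L n))"
begin

definition P :: "(nat \<Rightarrow> nat) monoid" where "P = product_group UNIV L"

definition T :: "(nat \<Rightarrow> nat) topology" where
  "T = product_topology (\<lambda>n. discrete_topology (carrier (L n))) UNIV"

lemma carrier_P: "x \<in> carrier P \<longleftrightarrow> (\<forall>n. x n \<in> carrier (L n))"
  by (auto simp: P_def)

lemma mult_P: "x \<otimes>\<^bsub>P\<^esub> y = (\<lambda>n. x n \<otimes>\<^bsub>L n\<^esub> y n)"
  by (simp add: P_def fun_eq_iff)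

lemma one_P: "\<one>\<^bsub>P\<^esub> = (\<lambda>n. \<one>\<^bsub>L n\<^esub>)"
  by (simp add: P_def fun_eq_iff)

sublocale P: group P
  unfolding P_def using group_L by simp

lemma inv_P: "x \<in> carrier P \<Longrightarrow> inv\<^bsub>P\<^esub> x = (\<lambda>n. inv\<^bsub>L n\<^esub> x n)"
  using inv_product_group[of x UNIV L] group_L by (simp add: P_def fun_eq_iff)

lemma pow_P: "x [^]\<^bsub>P\<^esub> (k::nat) = (\<lambda>n. x n [^]\<^bsub>L n\<^esub> k)"
  by (induction k) (simp_all add: one_P mult_P)

lemma topspace_T: "topspace T = carrier P"
  by (simp add: T_def P_def)

text \<open>A basic open set restricts finitely many coordinates; a common bound \<open>N\<close>
  for them replaces these by an initial segment.\<close>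

lemma openin_T_iff:
  "openin T U \<longleftrightarrow> U \<subseteq> carrier P \<and>
     (\<forall>g\<in>U. \<exists>N. \<forall>h\<in>carrier P. (\<forall>n<N. h n = g n) \<longrightarrow> h \<in> U)"
proof
  assume U: "openin T U"
  then have sub: "U \<subseteq> carrier P" using openin_subset topspace_T by blast
  have "\<exists>N. \<forall>h\<in>carrier P. (\<forall>n<N. h n = g n) \<longrightarrow> h \<in> U" if g: "g \<in> U" for g
  proof -
    obtain V where V: "finite {i. V i \<noteq> carrier (L i)}" "g \<in> PiE UNIV V" "PiE UNIV V \<subseteq> U"
      using U g unfolding T_def openin_product_topology_alt by auto
    obtain N where N: "\<And>i. V i \<noteq> carrier (L i) \<Longrightarrow> i < N"
      using V(1) finite_nat_set_iff_bounded by auto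
    have "h \<in> U" if h: "h \<in> carrier P" "\<forall>n<N. h n = g n" for h
    proof -
      have "h i \<in> V i" for i
      proof (cases "i < N")
        case True
        then show ?thesis using h V(2) by auto
      next
        case False
        then show ?thesis using N[of i] h(1) by (auto simp: carrier_P)
      qed
      then show ?thesis using V(3) by auto
    qed
    then show ?thesis by blast
  qed
  then show "U \<subseteq> carrier P \<and> (\<forall>g\<in>U. \<exists>N. \<forall>h\<in>carrier P. (\<forall>n<N. h n = g n) \<longrightarrow> h \<in> U)"
    using sub by blast
next
  assume U: "U \<subseteq> carrier P \<and> (\<forall>g\<in>U. \<exists>N. \<forall>h\<in>carrier P. (\<forall>n<N. h n = g n) \<longrightarrow> h \<in> U)"
  show "openin T U"
    unfolding T_def openin_product_topology_alt
  proof
    fix g assume g: "g \<in> U"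
    then obtain N where N: "\<And>h. h \<in> carrier P \<Longrightarrow> (\<And>n. n < N \<Longrightarrow> h n = g n) \<Longrightarrow> h \<in> U" using U by metis
    let ?V = "\<lambda>i. if i < N then {g i} else carrier (L i)"
    have gc: "g i \<in> carrier (L i)" for i using U g carrier_P by blast
    have 1: "finite {i \<in> UNIV. ?V i \<noteq> topspace (discrete_topology (carrier (L i)))}"
      by (rule finite_subset[of _ "{..<N}"]) auto
    have 2: "\<forall>i\<in>UNIV. openin (discrete_topology (carrier (L i))) (?V i)"
      using gc by simp
    have 3: "g \<in> PiE UNIV ?V" using gc by auto
    have 4: "PiE UNIV ?V \<subseteq> U"
    proof
      fix h assume "h \<in> PiE UNIV ?V"
      then have hV: "h i \<in> ?V i" for i by (rule PiE_mem) simp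
      have "h i \<in> carrier (L i)" for i using hV[of i] gc by (auto split: if_splits)
      moreover have "h i = g i" if "i < N" for i using hV[of i] that by simp
      ultimately show "h \<in> U" using N carrier_P by blast
    qed
    show "\<exists>V. finite {i \<in> UNIV. V i \<noteq> topspace (discrete_topology (carrier (L i)))} \<and>
        (\<forall>i\<in>UNIV. openin (discrete_topology (carrier (L i))) (V i)) \<and> g \<in> PiE UNIV V \<and> PiE UNIV V \<subseteq> U"
      using 1 2 3 4 by (intro exI[of _ ?V] conjI)
  qed
qed

lemma continuous_map_proj: "continuous_map T (discrete_topology (carrier (L n))) (\<lambda>x. x n)"
  unfolding T_def by (rule continuous_map_product_projection) simp

lemma continuous_map_T: "continuous_map Y T f \<longleftrightarrow> (\<forall>n. continuous_map Y (discrete_topology (carrier (L n))) (\<lambda>x. f x n))"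
  unfolding T_def by (rule continuous_map_componentwise_UNIV)

lemma profinite_P: "profinite_group P T"
proof -
  have "continuous_map (prod_topology T T) T (\<lambda>(x, y). x \<otimes>\<^bsub>P\<^esub> y)"
    unfolding continuous_map_T
  proof
    fix n
    let ?D = "discrete_topology (carrier (L n))"
    interpret group "L n" by (rule group_L)
    have "continuous_map (prod_topology T T) (prod_topology ?D ?D) (\<lambda>z. (fst z n, snd z n))"
      using continuous_map_compose[OF continuous_map_fst continuous_map_proj[of n], of T]
        continuous_map_compose[OF continuous_map_snd continuous_map_proj[of n], of T]
      by (intro continuous_map_pairedI) (simp_all add: o_def)
    moreover have "continuous_map (prod_topology ?D ?D) ?D (\<lambda>(a, b). a \<otimes>\<^bsub>L n\<^esub> b)"
      unfolding prod_topology_discrete_topology[symmetric] by auto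
    ultimately have "continuous_map (prod_topology T T) ?D ((\<lambda>(a, b). a \<otimes>\<^bsub>L n\<^esub> b) \<circ> (\<lambda>z. (fst z n, snd z n)))"
      by (rule continuous_map_compose)
    then show "continuous_map (prod_topology T T) ?D (\<lambda>z. (case z of (x, y) \<Rightarrow> x \<otimes>\<^bsub>P\<^esub> y) n)"
      by (simp add: o_def mult_P case_prod_unfold)
  qed
  moreover have "continuous_map T T (\<lambda>x. inv\<^bsub>P\<^esub> x)"
    unfolding continuous_map_T
  proof
    fix n
    let ?D = "discrete_topology (carrier (L n))"
    interpret group "L n" by (rule group_L)
    have "continuous_map ?D ?D (\<lambda>a. inv\<^bsub>L n\<^esub> a)" by auto
    then have "continuous_map T ?D ((\<lambda>a. inv\<^bsub>L n\<^esub> a) \<circ> (\<lambda>x. x n))"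
      by (rule continuous_map_compose[OF continuous_map_proj])
    then show "continuous_map T ?D (\<lambda>x. (inv\<^bsub>P\<^esub> x) n)"
      by (rule continuous_map_eq) (simp add: topspace_T inv_P)
  qed
  moreover have "compact_space T"
    unfolding T_def by (simp add: compact_space_product_topology compact_space_discrete_topology finite_L)
  moreover have "Hausdorff_space T"
    unfolding T_def by (simp add: Hausdorff_space_product_topology)
  moreover have "totally_disconnected_space T"
    unfolding totally_disconnected_space_def
  proof (intro allI impI)
    fix C assume C: "connectedin T C"
    show "C = {} \<or> (\<exists>a. C = {a})"
    proof (cases "C = {}")
      case False
      then obtain a where a: "a \<in> C" by blast
      \<comment> \<open>The projection of a connected set to a discrete factor is connected, hence a
        single point.\<close>
      have "b = a" if b: "b \<in> C" for b
      proof
        fix n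
        have "connectedin (discrete_topology (carrier (L n))) ((\<lambda>x. x n) ` C)"
          by (rule connectedin_continuous_map_image[OF continuous_map_proj C])
        then show "b n = a n" using a b by (auto simp: connectedin_discrete_topology)
      qed
      then show ?thesis using a by blast
    qed simp
  qed
  ultimately show ?thesis
    by (simp add: profinite_group_def topological_group_def topspace_T P.is_group)
qed

section \<open>Tails and the subgroups containing them\<close>

definition tail :: "nat \<Rightarrow> (nat \<Rightarrow> nat) set" where
  "tail N = {g \<in> carrier P. \<forall>n<N. g n = \<one>\<^bsub>L n\<^esub>}"

lemma tail_diff:
  assumes "g \<in> carrier P" "h \<in> carrier P" "\<forall>n<N. h n = g n"
  shows "inv\<^bsub>P\<^esub> g \<otimes>\<^bsub>P\<^esub> h \<in> tail N"
proof -
  have "(inv\<^bsub>P\<^esub> g \<otimes>\<^bsub>P\<^esub> h) n = \<one>\<^bsub>L n\<^esub>" if "n < N" for n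
  proof -
    interpret group "L n" by (rule group_L)
    have "g n \<in> carrier (L n)" using assms(1) carrier_P by blast
    then show ?thesis using assms that by (simp add: mult_P inv_P)
  qed
  then show ?thesis using assms by (simp add: tail_def)
qed

text \<open>\<open>H\<close> is a union of cosets of \<open>tail N\<close>, so membership is decided
  by the first \<open>N\<close> coordinates.\<close>

lemma agree_subgroup:
  assumes H: "subgroup H P" "tail N \<subseteq> H" and gh: "g \<in> H" "h \<in> carrier P" "\<forall>n<N. h n = g n"
  shows "h \<in> H"
proof -
  have g: "g \<in> carrier P" using subgroup.mem_carrier[OF H(1) gh(1)] .
  have "g \<otimes>\<^bsub>P\<^esub> (inv\<^bsub>P\<^esub> g \<otimes>\<^bsub>P\<^esub> h) \<in> H"
    using tail_diff[OF g gh(2,3)] H(2) by (intro subgroup.m_closed[OF H(1) gh(1)]) auto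
  moreover have "g \<otimes>\<^bsub>P\<^esub> (inv\<^bsub>P\<^esub> g \<otimes>\<^bsub>P\<^esub> h) = h"
    using g gh(2) by (simp flip: P.m_assoc)
  ultimately show ?thesis by simp
qed

lemma openin_subgroup_iff:
  assumes "subgroup H P" shows "openin T H \<longleftrightarrow> (\<exists>N. tail N \<subseteq> H)"
proof
  assume "openin T H"
  then obtain N where "\<And>h. h \<in> carrier P \<Longrightarrow> (\<forall>n<N. h n = \<one>\<^bsub>P\<^esub> n) \<Longrightarrow> h \<in> H"
    using subgroup.one_closed[OF assms] unfolding openin_T_iff by blast
  then show "\<exists>N. tail N \<subseteq> H" by (auto simp: tail_def one_P)
next
  assume "\<exists>N. tail N \<subseteq> H"
  then obtain N where N: "tail N \<subseteq> H" by blast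
  show "openin T H"
    unfolding openin_T_iff
    using subgroup.subset[OF assms] agree_subgroup[OF assms N] by blast
qed

lemma closedin_subgroup:
  assumes "subgroup H P" "tail N \<subseteq> H" shows "closedin T H"
proof -
  have "openin T (carrier P - H)"
    unfolding openin_T_iff
  proof (intro conjI ballI exI[of _ N] impI)
    fix g h assume gh: "g \<in> carrier P - H" "h \<in> carrier P" "\<forall>n<N. h n = g n"
    have "h \<notin> H"
    proof
      assume "h \<in> H"
      then have "g \<in> H" using gh by (intro agree_subgroup[OF assms, of h g]) auto
      then show False using gh(1) by blast
    qed
    then show "h \<in> carrier P - H" using gh by blast
  qed blast
  then show ?thesis
    using subgroup.subset[OF assms(1)] by (simp add: closedin_def topspace_T)
qed

text \<open>Such a subgroup is recovered from the restrictions of its elements to the first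
  \<open>N\<close> coordinates, and these form a subset of a finite set.\<close>

lemma finite_subgroups_tail: "finite {H. subgroup H P \<and> tail N \<subseteq> H}"
proof (rule finite_subset)
  let ?F = "PiE {..<N} (\<lambda>n. carrier (L n))"
  let ?r = "\<lambda>R. {g \<in> carrier P. restrict g {..<N} \<in> R}"
  show "finite (?r ` Pow ?F)" by (intro finite_imageI) (simp add: finite_PiE finite_L)
  show "{H. subgroup H P \<and> tail N \<subseteq> H} \<subseteq> ?r ` Pow ?F"
  proof
    fix H assume "H \<in> {H. subgroup H P \<and> tail N \<subseteq> H}"
    then have H: "subgroup H P" "tail N \<subseteq> H" by auto
    let ?R = "(\<lambda>g. restrict g {..<N}) ` H"
    have "restrict g {..<N} \<in> ?F" if "g \<in> H" for g
      using subgroup.mem_carrier[OF H(1) that] by (simp only: carrier_P restrict_PiE_iff) simp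
    then have "?R \<in> Pow ?F" by blast
    moreover have "?r ?R = H"
    proof (intro equalityI subsetI)
      fix h assume "h \<in> ?r ?R"
      then obtain g where g: "h \<in> carrier P" "g \<in> H" "restrict h {..<N} = restrict g {..<N}" by auto
      have "\<forall>n<N. h n = g n" using g(3) by (metis lessThan_iff restrict_apply')
      then show "h \<in> H" using agree_subgroup[OF H g(2,1)] by blast
    next
      fix h assume "h \<in> H"
      then show "h \<in> ?r ?R" using subgroup.mem_carrier[OF H(1)] by auto
    qed
    ultimately show "H \<in> ?r ` Pow ?F" by blast
  qed
qed

section \<open>Coordinate subgroups and closures\<close>

definition single :: "nat \<Rightarrow> nat \<Rightarrow> nat \<Rightarrow> nat" where
  "single n x = (\<lambda>m. if m = n then x else \<one>\<^bsub>L m\<^esub>)"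

lemma one_L [simp]: "\<one>\<^bsub>L n\<^esub> \<in> carrier (L n)"
  by (simp add: group.is_monoid group_L)

lemma single_carrier: "x \<in> carrier (L n) \<Longrightarrow> single n x \<in> carrier P"
  by (auto simp: single_def carrier_P)

lemma hom_single: "group_hom (L n) P (single n)"
proof (intro group_hom.intro group_hom_axioms.intro homI group_L P.is_group)
  show "single n (x \<otimes>\<^bsub>L n\<^esub> y) = single n x \<otimes>\<^bsub>P\<^esub> single n y" for x y
    using group.is_monoid[OF group_L] by (auto simp: single_def mult_P fun_eq_iff monoid.l_one)
qed (rule single_carrier)

lemma truncate_mem:
  assumes H: "subgroup H P" "\<And>n x. N \<le> n \<Longrightarrow> x \<in> carrier (L n) \<Longrightarrow> single n x \<in> H" and g: "g \<in> tail N"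
  shows "(\<lambda>n. if n < K then g n else \<one>\<^bsub>L n\<^esub>) \<in> H"
proof (induction K)
  case 0
  then show ?case using subgroup.one_closed[OF H(1)] by (simp add: one_P)
next
  case (Suc K)
  let ?t = "\<lambda>K n. if n < K then g n else \<one>\<^bsub>L n\<^esub>"
  have gc: "g n \<in> carrier (L n)" for n using g by (simp add: tail_def carrier_P)
  have "?t (Suc K) = ?t K \<otimes>\<^bsub>P\<^esub> single K (g K)"
    using gc group.is_monoid[OF group_L]
    by (auto simp: mult_P single_def fun_eq_iff monoid.l_one monoid.r_one less_Suc_eq)
  moreover have "single K (g K) \<in> H"
  proof (cases "N \<le> K")
    case True
    then show ?thesis using H(2) gc by blast
  next
    case False
    then have "single K (g K) = \<one>\<^bsub>P\<^esub>" using g by (auto simp: tail_def single_def one_P)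
    then show ?thesis using subgroup.one_closed[OF H(1)] by simp
  qed
  ultimately show ?case using subgroup.m_closed[OF H(1) Suc.IH] by simp
qed

text \<open>Truncations of a tail element are finite products of coordinate elements in
  \<open>H\<close>, and they converge to it.\<close>

lemma tail_subset_closure:
  assumes H: "subgroup H P" "\<And>n x. N \<le> n \<Longrightarrow> x \<in> carrier (L n) \<Longrightarrow> single n x \<in> H"
  shows "tail N \<subseteq> T closure_of H"
proof
  fix g assume g: "g \<in> tail N"
  then have gc: "g \<in> carrier P" by (simp add: tail_def)
  show "g \<in> T closure_of H"
    unfolding in_closure_of topspace_T
  proof (intro conjI gc allI impI)
    fix U assume "g \<in> U \<and> openin T U"
    then obtain K where K: "\<And>h. h \<in> carrier P \<Longrightarrow> (\<forall>n<K. h n = g n) \<Longrightarrow> h \<in> U"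
      unfolding openin_T_iff by blast
    let ?h = "\<lambda>n. if n < K then g n else \<one>\<^bsub>L n\<^esub>"
    have "?h \<in> U" using gc by (intro K) (auto simp: carrier_P)
    then show "\<exists>y. y \<in> H \<and> y \<in> U" using truncate_mem[OF H g, of K] by blast
  qed
qed

text \<open>Let \<open>h\<close> agree with a closure point \<open>g\<close> below \<open>N\<close>,
  and let \<open>y\<close> in \<open>H\<close> approximate \<open>g\<close>. The quotient of
  \<open>y\<close> and \<open>h\<close> lies in \<open>tail N\<close>; truncating it corrects
  \<open>y\<close> to an element of \<open>H\<close> close to \<open>h\<close>.\<close>

lemma subgroup_closure:
  assumes H: "subgroup H P" "\<And>n x. N \<le> n \<Longrightarrow> x \<in> carrier (L n) \<Longrightarrow> single n x \<in> H"
  shows "openin T (T closure_of H)"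
  unfolding openin_T_iff
proof (intro conjI ballI)
  show "T closure_of H \<subseteq> carrier P" using closure_of_subset_topspace[of T H] topspace_T by simp
  fix g assume g: "g \<in> T closure_of H"
  then have gc: "g \<in> carrier P" by (simp add: in_closure_of topspace_T)
  have "h \<in> T closure_of H" if h: "h \<in> carrier P" "\<forall>n<N. h n = g n" for h
    unfolding in_closure_of topspace_T
  proof (intro conjI h(1) allI impI)
    fix U assume "h \<in> U \<and> openin T U"
    then obtain K where K: "\<And>u. u \<in> carrier P \<Longrightarrow> (\<forall>n<K. u n = h n) \<Longrightarrow> u \<in> U"
      unfolding openin_T_iff by blast
    have near: "\<exists>y. y \<in> H \<and> y \<in> V" if "g \<in> V" "openin T V" for V
      using g that unfolding in_closure_of by blast
    have "\<exists>y. y \<in> H \<and> y \<in> {u \<in> carrier P. \<forall>n<max K N. u n = g n}"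
    proof (rule near)
      show "g \<in> {u \<in> carrier P. \<forall>n<max K N. u n = g n}" using gc by simp
      show "openin T {u \<in> carrier P. \<forall>n<max K N. u n = g n}"
        unfolding openin_T_iff by (intro conjI ballI exI[of _ "max K N"]) auto
    qed
    then obtain y where y: "y \<in> H" "\<forall>n<max K N. y n = g n" by blast
    have yc: "y \<in> carrier P" using subgroup.mem_carrier[OF H(1) y(1)] .
    have "inv\<^bsub>P\<^esub> y \<otimes>\<^bsub>P\<^esub> h \<in> tail N" using y(2) h by (intro tail_diff yc) auto
    note t = truncate_mem[OF H this, of K]
    let ?t = "\<lambda>n. if n < K then (inv\<^bsub>P\<^esub> y \<otimes>\<^bsub>P\<^esub> h) n else \<one>\<^bsub>L n\<^esub>"
    have "y \<otimes>\<^bsub>P\<^esub> ?t \<in> H" using subgroup.m_closed[OF H(1) y(1) t] .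
    moreover have "y \<otimes>\<^bsub>P\<^esub> ?t \<in> U"
    proof (rule K)
      show "y \<otimes>\<^bsub>P\<^esub> ?t \<in> carrier P" using subgroup.mem_carrier[OF H(1)] calculation by blast
      have "y \<otimes>\<^bsub>P\<^esub> (inv\<^bsub>P\<^esub> y \<otimes>\<^bsub>P\<^esub> h) = h" using yc h(1) by (simp flip: P.m_assoc)
      then have "(y \<otimes>\<^bsub>P\<^esub> (inv\<^bsub>P\<^esub> y \<otimes>\<^bsub>P\<^esub> h)) n = h n" for n by simp
      then show "\<forall>n<K. (y \<otimes>\<^bsub>P\<^esub> ?t) n = h n" by (simp add: mult_P)
    qed
    ultimately show "\<exists>y. y \<in> H \<and> y \<in> U" by blast
  qed
  then show "\<exists>N. \<forall>h\<in>carrier P. (\<forall>n<N. h n = g n) \<longrightarrow> h \<in> T closure_of H" by blast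
qed

lemma single_power_subgroup:
  assumes "x \<in> power_subgroup (L n) m" shows "single n x \<in> power_subgroup P m"
proof -
  interpret s: group_hom "L n" P "single n" by (rule hom_single)
  show ?thesis
  proof (rule s.generate_vimage[OF P.subgroup_power_subgroup s.G.powers_carrier])
    have "single n ` powers (L n) m \<subseteq> powers P m"
      unfolding powers_def by (auto simp: s.hom_nat_pow intro: s.hom_closed)
    then show "single n ` powers (L n) m \<subseteq> power_subgroup P m"
      unfolding power_subgroup_eq by (auto intro: generate.incl)
    show "x \<in> generate (L n) (powers (L n) m)" using assms by (simp add: power_subgroup_eq)
  qed
qed

lemma single_derived:
  assumes "x \<in> derived (L n) (carrier (L n))" shows "single n x \<in> derived_subgroup P"
proof -
  interpret s: group_hom "L n" P "single n" by (rule hom_single)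
  have "single n x \<in> derived P (single n ` carrier (L n))"
    using assms s.derived_img[of "carrier (L n)"] by blast
  also have "\<dots> \<subseteq> derived P (carrier P)" by (rule P.mono_derived) auto
  finally show ?thesis by (simp add: derived_subgroup_def)
qed

text \<open>Factors can be chosen coordinate by coordinate because the length \<open>k\<close> is
  common to all coordinates.\<close>

lemma prods_powers_P:
  assumes "g \<in> carrier P" "\<And>n. g n \<in> prods (L n) (powers (L n) m) k"
  shows "g \<in> prods P (powers P m) k"
  using assms
proof (induction k arbitrary: g)
  case 0
  then show ?case by (auto simp: one_P)
next
  case (Suc k)
  have "\<exists>y c. y \<in> prods (L n) (powers (L n) m) k \<and> c \<in> carrier (L n) \<and> g n = y \<otimes>\<^bsub>L n\<^esub> c [^]\<^bsub>L n\<^esub> m" for n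
  proof -
    obtain y u where yu: "y \<in> prods (L n) (powers (L n) m) k" "u \<in> powers (L n) m" "g n = y \<otimes>\<^bsub>L n\<^esub> u"
      by (rule group.prods_SucE[OF group_L Suc.prems(2)[of n]])
    then obtain c where "c \<in> carrier (L n)" "u = c [^]\<^bsub>L n\<^esub> m" by (auto simp: powers_def)
    then show ?thesis using yu by blast
  qed
  then obtain y c where yc: "\<And>n. y n \<in> prods (L n) (powers (L n) m) k" "\<And>n. c n \<in> carrier (L n)"
    "\<And>n. g n = y n \<otimes>\<^bsub>L n\<^esub> c n [^]\<^bsub>L n\<^esub> m" by metis
  have "y n \<in> carrier (L n)" for n
    using yc(1)[of n] group.prods_carrier[OF group_L group.powers_carrier[OF group_L], of n m k] by blast
  then have "y \<in> carrier P" by (simp add: carrier_P)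
  then have "y \<in> prods P (powers P m) k" using Suc.IH yc(1) by blast
  moreover have "c [^]\<^bsub>P\<^esub> m \<in> powers P m" using yc(2) by (auto simp: powers_def carrier_P)
  moreover have "g = y \<otimes>\<^bsub>P\<^esub> c [^]\<^bsub>P\<^esub> m" using yc(3) by (simp add: mult_P pow_P fun_eq_iff)
  ultimately show ?case using P.prods_SucI by blast
qed

text \<open>These subgroups play the role of $G'G^p$; they detect that an element has unbounded verbal
  length along the set \<open>A\<close> of coordinates.\<close>

definition bounded_verbal :: "nat \<Rightarrow> nat set \<Rightarrow> (nat \<Rightarrow> nat) set" where
  "bounded_verbal p A = {g \<in> carrier P. \<exists>k. \<forall>n\<in>A. g n \<in> prods (L n) (verbal (L n) p) k}"

lemma bounded_verbalI:
  "g \<in> carrier P \<Longrightarrow> (\<And>n. n \<in> A \<Longrightarrow> g n \<in> prods (L n) (verbal (L n) p) k) \<Longrightarrow> g \<in> bounded_verbal p A"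
  by (auto simp: bounded_verbal_def)

lemma subgroup_bounded_verbal: "subgroup (bounded_verbal p A) P"
proof (rule P.subgroupI)
  show "bounded_verbal p A \<subseteq> carrier P" by (auto simp: bounded_verbal_def)
  have "\<one>\<^bsub>P\<^esub> \<in> bounded_verbal p A"
    by (rule bounded_verbalI[where k = 0]) (simp_all add: one_P carrier_P)
  then show "bounded_verbal p A \<noteq> {}" by blast
  fix g assume "g \<in> bounded_verbal p A"
  then obtain k where g: "g \<in> carrier P" "\<And>n. n \<in> A \<Longrightarrow> g n \<in> prods (L n) (verbal (L n) p) k"
    by (auto simp: bounded_verbal_def)
  show "inv\<^bsub>P\<^esub> g \<in> bounded_verbal p A"
  proof (rule bounded_verbalI[where k = k])
    show "inv\<^bsub>P\<^esub> g \<in> carrier P" using g(1) by simp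
    show "(inv\<^bsub>P\<^esub> g) n \<in> prods (L n) (verbal (L n) p) k" if "n \<in> A" for n
      unfolding inv_P[OF g(1)]
      by (rule group.prods_inv[OF group_L group.verbal_carrier[OF group_L] group.verbal_inv[OF group_L] g(2)[OF that]])
  qed
  fix h assume "h \<in> bounded_verbal p A"
  then obtain l where h: "h \<in> carrier P" "\<And>n. n \<in> A \<Longrightarrow> h n \<in> prods (L n) (verbal (L n) p) l"
    by (auto simp: bounded_verbal_def)
  show "g \<otimes>\<^bsub>P\<^esub> h \<in> bounded_verbal p A"
  proof (rule bounded_verbalI[where k = "k + l"])
    show "g \<otimes>\<^bsub>P\<^esub> h \<in> carrier P" using g h by simp
    show "(g \<otimes>\<^bsub>P\<^esub> h) n \<in> prods (L n) (verbal (L n) p) (k + l)" if "n \<in> A" for n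
      unfolding mult_P
      by (rule group.prods_add[OF group_L group.verbal_carrier[OF group_L] g(2)[OF that] h(2)[OF that]])
  qed
qed

text \<open>A commutator or \<open>p\<close>-th power in the product is one in every coordinate, so
  \<open>k = 1\<close> is a uniform bound.\<close>

lemma verbal_bounded_verbal: "verbal P p \<subseteq> bounded_verbal p A"
proof
  fix v assume v: "v \<in> verbal P p"
  have "v n \<in> verbal (L n) p" for n
  proof -
    consider x y where "x \<in> carrier P" "y \<in> carrier P" "v = x \<otimes>\<^bsub>P\<^esub> y \<otimes>\<^bsub>P\<^esub> inv\<^bsub>P\<^esub> x \<otimes>\<^bsub>P\<^esub> inv\<^bsub>P\<^esub> y"
      | x where "x \<in> carrier P" "v = x [^]\<^bsub>P\<^esub> p"
      using v by (auto simp: verbal_def powers_def)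
    then show ?thesis
    proof cases
      case 1
      then have "v n = x n \<otimes>\<^bsub>L n\<^esub> y n \<otimes>\<^bsub>L n\<^esub> inv\<^bsub>L n\<^esub> x n \<otimes>\<^bsub>L n\<^esub> inv\<^bsub>L n\<^esub> y n"
        "x n \<in> carrier (L n)" "y n \<in> carrier (L n)"
        by (simp_all add: mult_P inv_P carrier_P)
      then show ?thesis unfolding verbal_def by blast
    next
      case 2
      then show ?thesis by (auto simp: verbal_def powers_def pow_P carrier_P)
    qed
  qed
  moreover have "v \<in> carrier P" using v P.verbal_carrier by blast
  ultimately show "v \<in> bounded_verbal p A"
    by (intro bounded_verbalI[where k = 1] group.prods_incl[OF group_L group.verbal_carrier[OF group_L]]) auto
qed

lemma derived_bounded_verbal: "derived_subgroup P \<subseteq> bounded_verbal p A"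
  and power_bounded_verbal: "power_subgroup P p \<subseteq> bounded_verbal p A"
  unfolding derived_subgroup_eq power_subgroup_eq
  using verbal_bounded_verbal[of p A]
  by (intro P.generate_subgroup_incl subgroup_bounded_verbal; auto simp: verbal_def)+

end

section \<open>Almost disjoint sets of coordinates\<close>

text \<open>For $s \ne t$ the integer parts of $s k$ and $t k$ differ as soon as $k \ge 1 / |s - t|$.\<close>

definition branch :: "nat \<Rightarrow> real \<Rightarrow> nat set" where
  "branch c t = range (\<lambda>k. prod_encode (c, prod_encode (k, int_encode \<lfloor>t * real k\<rfloor>)))"

lemma branch_fst: "n \<in> branch c t \<Longrightarrow> fst (prod_decode n) = c"
  by (auto simp: branch_def)

lemma infinite_branch: "infinite (branch c t)"
  unfolding branch_def by (rule range_inj_infinite) (auto simp: inj_on_def)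

lemma finite_branch_Int:
  assumes "s \<noteq> t" shows "finite (branch c s \<inter> branch c t)"
proof -
  obtain K :: nat where K: "1 / \<bar>s - t\<bar> < real K" using reals_Archimedean2 by blast
  have *: "k \<le> K" if "\<lfloor>s * real k\<rfloor> = \<lfloor>t * real k\<rfloor>" for k
  proof -
    have "\<bar>s * real k - t * real k\<bar> < 1" using that by linarith
    then have "\<bar>s - t\<bar> * real k < 1" by (simp add: abs_mult flip: left_diff_distrib)
    then have "real k < 1 / \<bar>s - t\<bar>" using assms by (simp add: pos_less_divide_eq mult.commute)
    then show ?thesis using K by linarith
  qed
  have "branch c s \<inter> branch c t \<subseteq> (\<lambda>k. prod_encode (c, prod_encode (k, int_encode \<lfloor>t * real k\<rfloor>))) ` {..K}"
  proof
    fix n assume "n \<in> branch c s \<inter> branch c t"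
    then obtain j k where n: "n = prod_encode (c, prod_encode (j, int_encode \<lfloor>s * real j\<rfloor>))"
      "n = prod_encode (c, prod_encode (k, int_encode \<lfloor>t * real k\<rfloor>))"
      by (auto simp: branch_def)
    then have "k \<le> K" by (intro *) (auto simp: int_encode_eq)
    then show "n \<in> (\<lambda>k. prod_encode (c, prod_encode (k, int_encode \<lfloor>t * real k\<rfloor>))) ` {..K}"
      using n(2) by simp
  qed
  then show ?thesis by (rule finite_subset) simp
qed

lemma uncountable_range_inj:
  fixes f :: "real \<Rightarrow> 'a"
  assumes "inj f" shows "uncountable (range f)"
  using assms uncountable_UNIV_real countable_image_inj_on by blast

section \<open>The profinite group\<close>

locale layer_product =
  fixes L :: "nat \<Rightarrow> nat monoid" and \<pi> :: "nat \<Rightarrow> nat" and S :: "nat set"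
  assumes layer_L: "\<And>n. layer (\<pi> n) n (L n)"
    and prime_S: "\<And>p. p \<in> S \<Longrightarrow> Factorial_Ring.prime p"
    and S_nonempty: "S \<noteq> {}"
    and \<pi>_def: "\<And>n. \<pi> n = from_nat_into S (fst (prod_decode n))"
begin

sublocale finite_product L
  by (rule finite_product.intro) (use layer_L in \<open>simp_all add: layer_def\<close>)

section \<open>Density, openness and finiteness\<close>

lemma perfect_L: "derived (L n) (carrier (L n)) = carrier (L n)"
  and power_L: "0 < m \<Longrightarrow> m \<le> n \<Longrightarrow> power_subgroup (L n) m = carrier (L n)"
  and width_L: "0 < m \<Longrightarrow> m \<le> n \<Longrightarrow> coprime m (\<pi> n) \<Longrightarrow> carrier (L n) \<subseteq> prods (L n) (powers (L n) m) 5"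
  and verbal_width_L: "\<not> carrier (L n) \<subseteq> prods (L n) (verbal (L n) (\<pi> n)) n"
  using layer_L[of n] by (simp_all add: layer_def)

lemma \<pi>_S: "\<pi> n \<in> S"
  unfolding \<pi>_def using S_nonempty by (rule from_nat_into)

text \<open>\<open>\<pi> n\<close> depends only on the first component of the decoded index, so all
  branches with the same \<open>c\<close> lie over one prime.\<close>

lemma \<pi>_branch:
  assumes "p \<in> S" shows "\<exists>c. \<forall>t. \<forall>n\<in>branch c t. \<pi> n = p"
proof -
  obtain c where "from_nat_into S c = p" using from_nat_into_surj[OF _ assms] by auto
  then show ?thesis by (intro exI[of _ c]) (simp add: \<pi>_def branch_fst)
qed

text \<open>Perfect factors put every coordinate element into the derived subgroup, and
  \<open>tail 0\<close> is the whole group.\<close>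

lemma dense_derived: "T closure_of (derived_subgroup P) = carrier P"
proof
  show "T closure_of (derived_subgroup P) \<subseteq> carrier P"
    using closure_of_subset_topspace[of T] topspace_T by simp
  have "tail 0 \<subseteq> T closure_of (derived_subgroup P)"
    by (intro tail_subset_closure P.subgroup_derived_subgroup single_derived) (simp add: perfect_L)
  then show "carrier P \<subseteq> T closure_of (derived_subgroup P)" by (auto simp: tail_def)
qed

lemma single_power: "0 < m \<Longrightarrow> m \<le> n \<Longrightarrow> x \<in> carrier (L n) \<Longrightarrow> single n x \<in> power_subgroup P m"
  by (rule single_power_subgroup) (simp add: power_L)

lemma open_closure_power: "0 < m \<Longrightarrow> openin T (T closure_of (power_subgroup P m))"
  by (rule subgroup_closure[OF P.subgroup_power_subgroup]) (rule single_power)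

lemma tail_closure_power: "0 < m \<Longrightarrow> tail m \<subseteq> T closure_of (power_subgroup P m)"
  by (rule tail_subset_closure[OF P.subgroup_power_subgroup]) (rule single_power)

text \<open>\<open>H\<close> contains all powers with exponent \<open>fact k\<close> and is closed
  because it is open. It therefore contains the closure of the subgroup they generate, and with it
  \<open>tail (fact k)\<close>.\<close>

lemma finite_open_index:
  assumes "k \<ge> 1"
  shows "finite {H. subgroup H P \<and> openin T H \<and> group_index P H = k}"
proof (rule finite_subset)
  show "finite {H. subgroup H P \<and> tail (fact k) \<subseteq> H}" by (rule finite_subgroups_tail)
  show "{H. subgroup H P \<and> openin T H \<and> group_index P H = k} \<subseteq> {H. subgroup H P \<and> tail (fact k) \<subseteq> H}"
  proof
    fix H assume "H \<in> {H. subgroup H P \<and> openin T H \<and> group_index P H = k}"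
    then have H: "subgroup H P" "openin T H" "group_index P H = k" by auto
    have "powers P (fact k) \<subseteq> H"
      using P.power_fact_index[OF H(1,3) assms] by (auto simp: powers_def)
    then have "power_subgroup P (fact k) \<subseteq> H"
      unfolding power_subgroup_eq by (rule P.generate_subgroup_incl[OF _ H(1)])
    moreover have "closedin T H" using H openin_subgroup_iff closedin_subgroup by blast
    ultimately have "T closure_of (power_subgroup P (fact k)) \<subseteq> H" by (rule closure_of_minimal)
    then show "H \<in> {H. subgroup H P \<and> tail (fact k) \<subseteq> H}"
      using tail_closure_power[of "fact k"] H by auto
  qed
qed

text \<open>Coordinates below \<open>m\<close> are trivial and all others are products of five
  \<open>m\<close>-th powers; the uniform 5 makes the whole element such a product.\<close>

lemma tail_power_coprime:
  assumes m: "m \<ge> 1" "\<forall>p\<in>S. coprime m p"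
  shows "tail m \<subseteq> power_subgroup P m"
proof
  fix g assume g: "g \<in> tail m"
  then have gc: "g \<in> carrier P" by (simp add: tail_def)
  have "g n \<in> prods (L n) (powers (L n) m) 5" for n
  proof (cases "n < m")
    case True
    then have "g n = \<one>\<^bsub>L n\<^esub>" using g by (simp add: tail_def)
    then show ?thesis using group.prods_one[OF group_L group.powers_one[OF group_L]] by simp
  next
    case False
    then show ?thesis using width_L[of m n] m \<pi>_S gc by (auto simp: carrier_P)
  qed
  then have "g \<in> prods P (powers P m) 5" by (rule prods_powers_P[OF gc])
  then show "g \<in> power_subgroup P m" using P.prods_power_subgroup by blast
qed

text \<open>By Lagrange a normal subgroup of index \<open>m\<close> contains all \<open>m\<close>-th
  powers, hence \<open>tail m\<close>.\<close>

lemma finite_normal_index_coprime: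
  assumes m: "m \<ge> 1" "\<forall>p\<in>S. coprime m p"
  shows "finite {N. N \<lhd> P \<and> group_index P N = m}"
proof (rule finite_subset)
  show "finite {H. subgroup H P \<and> tail m \<subseteq> H}" by (rule finite_subgroups_tail)
  show "{N. N \<lhd> P \<and> group_index P N = m} \<subseteq> {H. subgroup H P \<and> tail m \<subseteq> H}"
  proof
    fix N assume "N \<in> {N. N \<lhd> P \<and> group_index P N = m}"
    then have N: "N \<lhd> P" "group_index P N = m" by auto
    then have sN: "subgroup N P" by (simp add: normal_imp_subgroup)
    have "power_subgroup P m \<subseteq> N"
      unfolding power_subgroup_eq using normal.powers_subset_index[OF N(1)] N(2)
      by (intro P.generate_subgroup_incl sN) simp
    then show "N \<in> {H. subgroup H P \<and> tail m \<subseteq> H}"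
      using tail_power_coprime[OF m] sN by blast
  qed
qed

section \<open>Elements of unbounded verbal length\<close>

definition deep :: "nat \<Rightarrow> nat" where
  "deep n = (SOME x. x \<in> carrier (L n) \<and> x \<notin> prods (L n) (verbal (L n) (\<pi> n)) n)"

lemma deep: "deep n \<in> carrier (L n)" "deep n \<notin> prods (L n) (verbal (L n) (\<pi> n)) n"
proof -
  have "\<exists>x. x \<in> carrier (L n) \<and> x \<notin> prods (L n) (verbal (L n) (\<pi> n)) n"
    using verbal_width_L by blast
  from someI_ex[OF this] show "deep n \<in> carrier (L n)" "deep n \<notin> prods (L n) (verbal (L n) (\<pi> n)) n"
    by (simp_all add: deep_def)
qed

definition spread :: "nat set \<Rightarrow> nat \<Rightarrow> nat" where
  "spread A = (\<lambda>n. if n \<in> A then deep n else \<one>\<^bsub>L n\<^esub>)"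

lemma spread_carrier: "spread A \<in> carrier P"
  by (auto simp: spread_def carrier_P deep)

text \<open>Every bound \<open>k\<close> fails at some index \<open>n \<ge> k\<close> in both sets,
  where \<open>deep n\<close> is not even a product of \<open>n\<close> verbal elements.\<close>

lemma spread_notin:
  assumes "infinite (A \<inter> B)" "\<And>n. n \<in> A \<inter> B \<Longrightarrow> \<pi> n = p"
  shows "spread A \<notin> bounded_verbal p B"
proof
  assume "spread A \<in> bounded_verbal p B"
  then obtain k where k: "\<And>n. n \<in> B \<Longrightarrow> spread A n \<in> prods (L n) (verbal (L n) p) k"
    by (auto simp: bounded_verbal_def)
  obtain n where n: "n \<ge> k" "n \<in> A \<inter> B"
    using assms(1) unfolding infinite_nat_iff_unbounded_le by blast
  have "deep n \<in> prods (L n) (verbal (L n) p) k" using k[of n] n by (simp add: spread_def)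
  then have "deep n \<in> prods (L n) (verbal (L n) p) n"
    using group.prods_mono[OF group_L group.verbal_carrier[OF group_L] group.verbal_one[OF group_L] n(1)] by blast
  then show False using deep(2)[of n] assms(2)[OF n(2)] by simp
qed

text \<open>Each \<open>deep n\<close> has finite verbal length because its factor is perfect. Only
  finitely many of these lengths matter on \<open>B\<close>, so they have a common bound.\<close>

lemma spread_in:
  assumes "finite (A \<inter> B)"
  shows "spread A \<in> bounded_verbal p B"
proof -
  have "\<exists>k. deep n \<in> prods (L n) (verbal (L n) p) k" for n
    using group.derived_subset_prods[OF group_L, of "deep n" n p] deep(1) perfect_L by simp
  then obtain k where k: "\<And>n. deep n \<in> prods (L n) (verbal (L n) p) (k n)" by metis
  obtain K where K: "\<And>n. n \<in> A \<inter> B \<Longrightarrow> k n \<le> K"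
    using assms finite_nat_set_iff_bounded_le[of "k ` (A \<inter> B)"] by auto
  show ?thesis
  proof (rule bounded_verbalI[OF spread_carrier, where k = K])
    fix n assume n: "n \<in> B"
    show "spread A n \<in> prods (L n) (verbal (L n) p) K"
    proof (cases "n \<in> A")
      case True
      then have "k n \<le> K" using K n by blast
      then show ?thesis
        using group.prods_mono[OF group_L group.verbal_carrier[OF group_L] group.verbal_one[OF group_L], of "k n" K n p] k[of n] True
        by (simp add: spread_def subset_iff)
    next
      case False
      then show ?thesis
        using group.prods_one[OF group_L group.verbal_one[OF group_L]] by (simp add: spread_def)
    qed
  qed
qed

text \<open>For each real \<open>t\<close> a maximal \<open>M t\<close> contains
  \<open>bounded_verbal p (branch c t)\<close> and avoids \<open>spread (branch c t)\<close>. For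
  \<open>s \<noteq> t\<close> almost disjointness puts \<open>spread (branch c s)\<close> into
  \<open>M t\<close>, while \<open>M s\<close> avoids it.\<close>

lemma uncountable_normal_index:
  assumes p: "p \<in> S"
  shows "uncountable {N. N \<lhd> P \<and> group_index P N = p}"
proof -
  obtain c where c: "\<And>t n. n \<in> branch c t \<Longrightarrow> \<pi> n = p" using \<pi>_branch[OF p] by blast
  have out: "spread (branch c t) \<notin> bounded_verbal p (branch c t)" for t
    using c infinite_branch by (intro spread_notin) auto
  have "\<exists>M. M \<lhd> P \<and> bounded_verbal p (branch c t) \<subseteq> M \<and> spread (branch c t) \<notin> M \<and> group_index P M = p" for t
  proof -
    have "powers P p \<subseteq> bounded_verbal p (branch c t)"
      using verbal_bounded_verbal by (auto simp: verbal_def)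
    then obtain M where "M \<lhd> P" "bounded_verbal p (branch c t) \<subseteq> M" "spread (branch c t) \<notin> M" "group_index P M = p"
      using P.maximal_avoiding[OF subgroup_bounded_verbal derived_bounded_verbal[unfolded derived_subgroup_def] _ prime_S[OF p] spread_carrier out]
      by metis
    then show ?thesis by blast
  qed
  then obtain M where M: "\<And>t. M t \<lhd> P" "\<And>t. bounded_verbal p (branch c t) \<subseteq> M t"
    "\<And>t. spread (branch c t) \<notin> M t" "\<And>t. group_index P (M t) = p" by metis
  have "inj M"
  proof (rule injI)
    fix s t assume eq: "M s = M t"
    show "s = t"
    proof (rule ccontr)
      assume "s \<noteq> t"
      then have "spread (branch c s) \<in> bounded_verbal p (branch c t)"
        by (intro spread_in finite_branch_Int)
      then show False using M(2)[of t] M(3)[of s] eq by blast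
    qed
  qed
  then have "uncountable (range M)" by (rule uncountable_range_inj)
  moreover have "range M \<subseteq> {N. N \<lhd> P \<and> group_index P N = p}" using M by blast
  ultimately show ?thesis using countable_subset by blast
qed

text \<open>Elements spread over different branches lie in different cosets; otherwise
  \<open>spread (branch c t)\<close> would have bounded length on its own branch.\<close>

lemma infinite_quotient:
  assumes p: "p \<in> S"
  shows "infinite (carrier (P Mod (derived_subgroup P <#>\<^bsub>P\<^esub> power_subgroup P p)))"
proof
  let ?D = "derived_subgroup P <#>\<^bsub>P\<^esub> power_subgroup P p"
  obtain c where c: "\<And>t n. n \<in> branch c t \<Longrightarrow> \<pi> n = p" using \<pi>_branch[OF p] by blast
  have D: "?D \<subseteq> bounded_verbal p A" for A
    using derived_bounded_verbal power_bounded_verbal subgroup.m_closed[OF subgroup_bounded_verbal]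
    unfolding set_mult_def by blast
  have "\<one>\<^bsub>P\<^esub> \<otimes>\<^bsub>P\<^esub> \<one>\<^bsub>P\<^esub> \<in> ?D"
    unfolding set_mult_def
    using subgroup.one_closed[OF P.subgroup_derived_subgroup] subgroup.one_closed[OF P.subgroup_power_subgroup, of p]
    by blast
  then have one: "\<one>\<^bsub>P\<^esub> \<in> ?D" by simp
  let ?f = "\<lambda>t. ?D #>\<^bsub>P\<^esub> spread (branch c t)"
  have "inj ?f"
  proof (rule injI)
    fix s t assume eq: "?f s = ?f t"
    show "s = t"
    proof (rule ccontr)
      assume st: "s \<noteq> t"
      have "\<one>\<^bsub>P\<^esub> \<otimes>\<^bsub>P\<^esub> spread (branch c s) \<in> ?f s" using one unfolding r_coset_def by blast
      then have "spread (branch c s) \<in> ?f t" using spread_carrier eq by simp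
      then obtain d where d: "d \<in> ?D" "spread (branch c s) = d \<otimes>\<^bsub>P\<^esub> spread (branch c t)"
        unfolding r_coset_def by blast
      have db: "d \<in> bounded_verbal p (branch c t)" using d(1) D by blast
      then have dc: "d \<in> carrier P" by (simp add: bounded_verbal_def)
      have "inv\<^bsub>P\<^esub> d \<otimes>\<^bsub>P\<^esub> spread (branch c s) \<in> bounded_verbal p (branch c t)"
        using st by (intro subgroup.m_closed[OF subgroup_bounded_verbal] subgroup.m_inv_closed[OF subgroup_bounded_verbal]
            db spread_in finite_branch_Int)
      moreover have "inv\<^bsub>P\<^esub> d \<otimes>\<^bsub>P\<^esub> spread (branch c s) = spread (branch c t)"
        unfolding d(2) using dc spread_carrier by (simp flip: P.m_assoc)
      ultimately show False
        using spread_notin[of "branch c t" "branch c t" p] c infinite_branch by auto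
    qed
  qed
  then have "infinite (range ?f)" using infinite_UNIV_char_0[where 'a = real] finite_imageD by blast
  moreover have "range ?f \<subseteq> carrier (P Mod ?D)"
    unfolding carrier_FactGroup using spread_carrier by blast
  moreover assume "finite (carrier (P Mod ?D))"
  ultimately show False using finite_subset by blast
qed

text \<open>A quotient of prime order is abelian, so \<open>N\<close> contains the dense derived
  subgroup. An open \<open>N\<close> is closed and would be the whole group, of index 1.\<close>

lemma normal_index_not_open:
  assumes p: "p \<in> S" and N: "N \<lhd> P" "group_index P N = p"
  shows "\<not> openin T N"
proof
  assume "openin T N"
  have sN: "subgroup N P" using N(1) by (simp add: normal_imp_subgroup)
  have "derived_subgroup P \<subseteq> N"
    unfolding derived_subgroup_def using normal.derived_subset_prime_index[OF N(1)] N(2) prime_S[OF p] by simp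
  moreover have "closedin T N" using \<open>openin T N\<close> sN openin_subgroup_iff closedin_subgroup by blast
  ultimately have "carrier P \<subseteq> N" using closure_of_minimal dense_derived by metis
  then have NP: "N = carrier P" using subgroup.subset[OF sN] by blast
  have "rcosets\<^bsub>P\<^esub> N \<subseteq> {carrier P}"
    unfolding RCOSETS_def NP using P.coset_join2[OF _ P.subgroup_self] by blast
  then have "group_index P N \<le> 1"
    unfolding group_index_def using card_mono[of "{carrier P}"] by simp
  then show False using N(2) prime_gt_1_nat[OF prime_S[OF p]] by simp
qed

text \<open>A closed dense subgroup is everything, but an element spread over a branch lies outside
  the derived subgroup.\<close>

lemma derived_not_closed: "\<not> closedin T (derived_subgroup P)"
proof
  assume "closedin T (derived_subgroup P)"
  then have eq: "derived_subgroup P = carrier P" using dense_derived closure_of_closedin by metis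
  obtain p where p: "p \<in> S" using S_nonempty by blast
  obtain c where c: "\<And>t n. n \<in> branch c t \<Longrightarrow> \<pi> n = p" using \<pi>_branch[OF p] by blast
  have "spread (branch c 0) \<in> derived_subgroup P" unfolding eq by (rule spread_carrier)
  then have "spread (branch c 0) \<in> bounded_verbal p (branch c 0)" using derived_bounded_verbal by blast
  then show False using spread_notin[of "branch c 0" "branch c 0" p] c infinite_branch by auto
qed

lemma power_not_closed:
  assumes p: "p \<in> S" shows "\<not> closedin T (power_subgroup P p)"
proof
  assume "closedin T (power_subgroup P p)"
  then have "tail p \<subseteq> power_subgroup P p"
    using tail_closure_power[OF prime_gt_0_nat[OF prime_S[OF p]]] closure_of_closedin by metis
  obtain c where c: "\<And>t n. n \<in> branch c t \<Longrightarrow> \<pi> n = p" using \<pi>_branch[OF p] by blast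
  \<comment> \<open>Dropping the indices below \<open>p\<close> moves the spread element into
    \<open>tail p\<close> and keeps the index set infinite.\<close>
  let ?A = "branch c 0 - {..<p}"
  have "spread ?A \<in> tail p" using spread_carrier[of ?A] by (auto simp: tail_def spread_def)
  then have "spread ?A \<in> bounded_verbal p ?A"
    using \<open>tail p \<subseteq> power_subgroup P p\<close> power_bounded_verbal by blast
  moreover have "infinite ?A" using infinite_branch by simp
  ultimately show False using spread_notin[of ?A ?A p] c by auto
qed

end

theorem theorem1:
  fixes S :: "nat set"
  assumes "S \<noteq> {}" and "\<forall>p\<in>S. Factorial_Ring.prime p"
  shows "\<exists>(G :: (nat \<Rightarrow> nat) monoid) (T :: (nat \<Rightarrow> nat) topology).
    profinite_group G T \<and>
    \<comment> \<open>(1) topologically perfect\<close>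
    carrier G = T closure_of (derived_subgroup G) \<and>
    \<comment> \<open>(2)\<close>
    (\<forall>m::nat. m \<ge> 1 \<longrightarrow> openin T (T closure_of (power_subgroup G m))) \<and>
    (\<forall>k::nat. k \<ge> 1 \<longrightarrow>
       finite {H. subgroup H G \<and> openin T H \<and> group_index G H = k}) \<and>
    \<comment> \<open>(3)\<close>
    (\<forall>m::nat. m \<ge> 1 \<and> (\<forall>p\<in>S. coprime m p) \<longrightarrow>
       openin T (power_subgroup G m) \<and>
       finite {N. N \<lhd> G \<and> group_index G N = m}) \<and>
    \<comment> \<open>(4)\<close>
    (\<forall>p\<in>S.
       infinite (carrier (G Mod (derived_subgroup G <#>\<^bsub>G\<^esub> power_subgroup G p))) \<and>
       uncountable {N. N \<lhd> G \<and> group_index G N = p} \<and>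
       (\<forall>N. N \<lhd> G \<and> group_index G N = p \<longrightarrow> \<not> openin T N)) \<and>
    \<comment> \<open>(5)\<close>
    \<not> closedin T (derived_subgroup G) \<and>
    (\<forall>p\<in>S. \<not> closedin T (power_subgroup G p))"
proof -
  \<comment> \<open>The index codes a pair whose first component selects the prime, so each prime of
    \<open>S\<close> occurs at infinitely many indices.\<close>
  define \<pi> where "\<pi> = (\<lambda>n. from_nat_into S (fst (prod_decode n)))"
  have "Factorial_Ring.prime (\<pi> n)" for n
    using from_nat_into[OF assms(1)] assms(2) by (simp add: \<pi>_def)
  then have "\<forall>n. \<exists>L :: nat monoid. layer (\<pi> n) n L" using nat_layer_exists by blast
  then obtain L :: "nat \<Rightarrow> nat monoid" where L: "\<And>n. layer (\<pi> n) n (L n)" by metis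
  interpret layer_product L \<pi> S
    by unfold_locales (use L assms in \<open>auto simp: \<pi>_def\<close>)
  have "openin T (power_subgroup P m)" if "m \<ge> 1" "\<forall>p\<in>S. coprime m p" for m
    using tail_power_coprime[OF that] openin_subgroup_iff[OF P.subgroup_power_subgroup] by blast
  then show ?thesis
    using profinite_P dense_derived open_closure_power finite_open_index finite_normal_index_coprime
      uncountable_normal_index infinite_quotient normal_index_not_open derived_not_closed power_not_closed
    by (intro exI[of _ P] exI[of _ T] conjI allI ballI impI) auto
qed

end
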